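(* If $\psi\in C^{\infty}(\mathbb{R}^n\times[0,T])$ is a viscosity super-solution of the Hamilton-Jacobi equation \[\max\Big\{\partial_t u(\bm{x},t)+H(\bm{x},\nabla_{\bm{x}}u),\ \max_{i\in\{1,\dots,n_{\mathcal{X}}\}}g_i(\bm{x},t)-u(\bm{x},t)\Big\}=0,\qquad H(\bm{x},\bm{p})=\max_{\bm{d}\in\mathcal{D}}\bm{p}\cdot\bm{F}(\bm{x},\bm{d}),\] with boundary condition \[\psi(\bm{x},T)\ge\max\Big\{\max_{i\in\{1,\dots,n_{\mathtt{TR}}\}}l_i(\bm{x}),\ \max_{i\in\{1,\dots,n_{\mathcal{X}}\}}g_i(\bm{x},T)\Big\}\quad\text{for all }\bm{x}\in\mathbb{R}^n,\] then $\{\bm{x}\in\mathbb{R}^n\mid\psi(\bm{x},0)\le0\}$ is an inner-approximation of the backward reachable set $\mathcal{R}_0$, i.e. $\{\bm{x}\in\mathbb{R}^n\mid\psi(\bm{x},0)\le0\}\subseteq\mathcal{R}_0$.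
   Context: Setting. $n,m$ are positive integers, $T>0$. $\bm{f}$ is a vector field with polynomial components $f_i\in\mathbb{R}[\bm{x},\bm{d}]$, $i=1,\dots,n$, $\bm{x}\in\mathbb{R}^n$, $\bm{d}\in\mathbb{R}^m$. $\mathcal{D}=\{\bm{d}\in\mathbb{R}^m\mid h_i(\bm{d})\ge0,\ i=1,\dots,n_{\mathcal{D}}\}$ is compact, with $h_i\in\mathbb{R}[\bm{d}]$. For $t\in[0,T]$, $\mathcal{X}_t=\{\bm{x}\in\mathbb{R}^n\mid g_i(\bm{x},t)\le0,\ i=1,\dots,n_{\mathcal{X}}\}$ is compact, with $g_i\in\mathbb{R}[\bm{x},t]$ and $\partial\mathcal{X}_t=\bigcup_{i}\{\bm{x}\in\mathcal{X}_t\mid g_i(\bm{x},t)=0\}$. The target region is $\mathtt{TR}=\{\bm{x}\in\mathbb{R}^n\mid l_i(\bm{x})\le0,\ i=1,\dots,n_{\mathtt{TR}}\}$ with $l_i\in\mathbb{R}[\bm{x}]$ and $\partial\mathtt{TR}=\bigcup_i\{\bm{x}\in\mathtt{TR}\mid l_i(\bm{x})=0\}$. $R>0$ is a number and $B(\bm{0},R)=\{\bm{x}\in\mathbb{R}^n\mid R-\sum_{i=1}^n x_i^2\ge0\}$, chosen so that for all $t\in[0,T]$: $\mathcal{X}_t\subseteq B(\bm{0},R)$ and $\partial\mathcal{X}_t\cap\partial B(\bm{0},R)=\emptyset$. $\bm{F}:\mathbb{R}^n\times\mathcal{D}\to\mathbb{R}^n$ is a continuous map, globally Lipschitz in $\bm{x}\in\mathbb{R}^n$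 uniformly in $\bm{d}\in\mathcal{D}$, with $\bm{F}=\bm{f}$ on $B(\bm{0},R)\times\mathcal{D}$. $\mathcal{M}_0$ is the set of measurable functions $\bm{d}:[0,T]\to\mathcal{D}$; for $\bm{d}\in\mathcal{M}_0$, $\bm{y}_{\bm{x}_0,0}^{\bm{d}}$ is the solution of $\dot{\bm{x}}(s)=\bm{f}(\bm{x}(s),\bm{d}(s))$ for a.e. $s\in[0,T]$ with value $\bm{x}_0$ at time $0$. Backward reachable set: $\mathcal{R}_0=\{\bm{x}_0\mid \forall\bm{d}\in\mathcal{M}_0:\ \bm{y}_{\bm{x}_0,0}^{\bm{d}}(T)\in\mathtt{TR}\text{ and }\bm{y}_{\bm{x}_0,0}^{\bm{d}}(s)\in\mathcal{X}_s\text{ for }s\in[0,T]\}$. $C^\infty(X)$ is the space of infinitely differentiable functions on $X$. A lower semi-continuous function $w$ on $\mathbb{R}^n\times[0,T]$ is a viscosity super-solution of the equation if for every test function $v\in C^\infty(\mathbb{R}^n\times[0,T])$ such that $w-v$ attains a local minimum at $(\bm{y}_0,t_0)\in\mathbb{R}^n\times[0,T]$, \[\max\Big\{\partial_t v(\bm{y}_0,t_0)+H(\bm{y}_0,\nabla_{\bm{x}}v(\bm{y}_0,t_0)),\ \max_{i\in\{1,\dots,n_{\mathcal{X}}\}} g_i(\bm{y}_0,t_0)-w(\bm{y}_0,t_0)\Big\}\le0.\] *)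

theory Defs
  imports "HOL-Analysis.Analysis"
begin

definition time_strip :: "real \<Rightarrow> ('a::euclidean_space \<times> real) set" where
  "time_strip T = UNIV \<times> {0..T}"

(* C^k and C^infinity on a set that need not be open: derivatives are taken relative to S, hence
   are one-sided in time at t = 0 and t = T when S is the strip. For T > 0 they are unique there,
   so the existential quantifier below leaves no freedom. *)
primrec Ck_on :: "nat \<Rightarrow> 'a::euclidean_space set \<Rightarrow> ('a \<Rightarrow> real) \<Rightarrow> bool" where
  "Ck_on 0 S v \<longleftrightarrow> continuous_on S v"
| "Ck_on (Suc k) S v \<longleftrightarrow>
     (\<exists>v'. (\<forall>z\<in>S. (v has_derivative v' z) (at z within S)) \<and>
           (\<forall>b\<in>Basis. Ck_on k S (\<lambda>z. v' z b)))"

definition Cinf_on :: "'a::euclidean_space set \<Rightarrow> ('a \<Rightarrow> real) \<Rightarrow> bool" where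
  "Cinf_on S v \<longleftrightarrow> (\<forall>k. Ck_on k S v)"

definition lower_semicontinuous_on ::
    "'a::topological_space set \<Rightarrow> ('a \<Rightarrow> real) \<Rightarrow> bool" where
  "lower_semicontinuous_on S w \<longleftrightarrow>
     (\<forall>z\<in>S. \<forall>c. c < w z \<longrightarrow> (\<forall>\<^sub>F y in at z within S. c < w y))"

definition local_min_on :: "'a::metric_space set \<Rightarrow> ('a \<Rightarrow> real) \<Rightarrow> 'a \<Rightarrow> bool" where
  "local_min_on S u z \<longleftrightarrow> z \<in> S \<and> (\<exists>e>0. \<forall>y \<in> S \<inter> ball z e. u z \<le> u y)"

definition grad_x :: "('a::euclidean_space \<times> real \<Rightarrow> real) \<Rightarrow> 'a \<Rightarrow> real \<Rightarrow> 'a" where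
  "grad_x v x t = (THE p. GDERIV (\<lambda>y. v (y, t)) x :> p)"

definition time_deriv :: "real \<Rightarrow> ('a \<times> real \<Rightarrow> real) \<Rightarrow> 'a \<Rightarrow> real \<Rightarrow> real" where
  "time_deriv T v x t = vector_derivative (\<lambda>s. v (x, s)) (at t within {0..T})"

definition superlevel_region :: "nat \<Rightarrow> (nat \<Rightarrow> 'a \<Rightarrow> real) \<Rightarrow> 'a set" where
  "superlevel_region k h = {d. \<forall>i\<in>{1..k}. 0 \<le> h i d}"

definition sublevel_region :: "nat \<Rightarrow> (nat \<Rightarrow> 'a \<Rightarrow> real) \<Rightarrow> 'a set" where
  "sublevel_region k l = {x. \<forall>i\<in>{1..k}. l i x \<le> 0}"

definition state_region :: "nat \<Rightarrow> (nat \<Rightarrow> 'a \<Rightarrow> real \<Rightarrow> real) \<Rightarrow> real \<Rightarrow> 'a set" where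
  "state_region k g t = sublevel_region k (\<lambda>i x. g i x t)"

(* The boundary of X_t is by convention the set of points of X_t at which some constraint is
   active. As X_t is closed, it contains the topological boundary but may be larger. *)
definition state_boundary :: "nat \<Rightarrow> (nat \<Rightarrow> 'a \<Rightarrow> real \<Rightarrow> real) \<Rightarrow> real \<Rightarrow> 'a set" where
  "state_boundary k g t = (\<Union>i\<in>{1..k}. {x \<in> state_region k g t. g i x t = 0})"

(* R is the square of the radius. *)
definition B0 :: "real \<Rightarrow> (real^'n) set" where
  "B0 R = {x. 0 \<le> R - (\<Sum>i\<in>UNIV. (x $ i)\<^sup>2)}"

definition max_upto :: "nat \<Rightarrow> (nat \<Rightarrow> real) \<Rightarrow> real" where
  "max_upto k a = Max (a ` {1..k})"

(* The supremum is a maximum when D is nonempty and compact and F x is continuous on D. *)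
definition Hamiltonian ::
    "('a::euclidean_space \<Rightarrow> 'b \<Rightarrow> 'a) \<Rightarrow> 'b set \<Rightarrow> 'a \<Rightarrow> 'a \<Rightarrow> real" where
  "Hamiltonian F D x p = (SUP d\<in>D. p \<bullet> F x d)"

(* Viscosity super-solution of
     max {d_t u + H(x, grad_x u), max_i g_i - u} = 0.
   Minima are taken relative to the strip and may be attained at t0 = 0, but the inequality is
   not required at the terminal time t0 = T, where the boundary condition is prescribed instead.
   Requiring it there as well could never hold for a smooth w: the test functions
   v = w + C * (t - T) with C > 0 touch w from below at t0 = T with d_t v = d_t w + C arbitrarily
   large. The condition below is implied by the one tested on all of [0,T]. *)
definition viscosity_supersolution ::
    "real \<Rightarrow> ('a::euclidean_space \<Rightarrow> 'a \<Rightarrow> real) \<Rightarrow> nat \<Rightarrow> (nat \<Rightarrow> 'a \<Rightarrow> real \<Rightarrow> real) \<Rightarrow>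
      ('a \<times> real \<Rightarrow> real) \<Rightarrow> bool" where
  "viscosity_supersolution T H nX g w \<longleftrightarrow>
     lower_semicontinuous_on (time_strip T) w \<and>
     (\<forall>v y0 t0. Cinf_on (time_strip T) v \<longrightarrow> t0 \<in> {0..<T} \<longrightarrow>
        local_min_on (time_strip T) (\<lambda>z. w z - v z) (y0, t0) \<longrightarrow>
        max (time_deriv T v y0 t0 + H y0 (grad_x v y0 t0))
            (max_upto nX (\<lambda>i. g i y0 t0) - w (y0, t0)) \<le> 0)"

definition controls :: "real \<Rightarrow> 'b::euclidean_space set \<Rightarrow> (real \<Rightarrow> 'b) set" where
  "controls T D = {d. d \<in> borel_measurable (lebesgue_on {0..T}) \<and> (\<forall>s\<in>{0..T}. d s \<in> D)}"

(* A division of its own union is a finite family of non-overlapping compact intervals k, with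
   end points Inf k and Sup k. *)
definition abs_continuous_on_interval ::
    "real \<Rightarrow> real \<Rightarrow> (real \<Rightarrow> 'a::real_normed_vector) \<Rightarrow> bool" where
  "abs_continuous_on_interval a b y \<longleftrightarrow>
     (\<forall>\<epsilon>>0. \<exists>\<delta>>0. \<forall>I. I division_of (\<Union>I) \<longrightarrow> \<Union>I \<subseteq> {a..b} \<longrightarrow>
        (\<Sum>k\<in>I. Sup k - Inf k) < \<delta> \<longrightarrow> (\<Sum>k\<in>I. norm (y (Sup k) - y (Inf k))) < \<epsilon>)"

(* Caratheodory solution on [0,T]; without absolute continuity an equation holding only almost
   everywhere would not determine y. *)
definition ode_solution ::
    "real \<Rightarrow> ('a::euclidean_space \<Rightarrow> 'b \<Rightarrow> 'a) \<Rightarrow> (real \<Rightarrow> 'b) \<Rightarrow> 'a \<Rightarrow> (real \<Rightarrow> 'a) \<Rightarrow> bool" where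
  "ode_solution T f d x0 y \<longleftrightarrow>
     abs_continuous_on_interval 0 T y \<and> y 0 = x0 \<and>
     (AE s in lebesgue_on {0..T}. (y has_vector_derivative f (y s) (d s)) (at s within {0..T}))"

(* f is only locally Lipschitz, so the solution may blow up before T; membership requires it to
   exist on all of [0,T]. Solutions are unique on [0,T], so the universally quantified y is
   "the" solution. *)
definition backward_reachable_set ::
    "real \<Rightarrow> ('a::euclidean_space \<Rightarrow> 'b::euclidean_space \<Rightarrow> 'a) \<Rightarrow> 'b set \<Rightarrow> 'a set \<Rightarrow>
      (real \<Rightarrow> 'a set) \<Rightarrow> 'a set" where
  "backward_reachable_set T f D TR X =
     {x0. \<forall>d \<in> controls T D.
        (\<exists>y. ode_solution T f d x0 y) \<and>
        (\<forall>y. ode_solution T f d x0 y \<longrightarrow> y T \<in> TR \<and> (\<forall>s\<in>{0..T}. y s \<in> X s))}"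

end

theory Submission
  imports Defs
begin

text \<open>A smooth super-solution \<open>\<psi>\<close> is its own test function, so \<open>\<partial>\<^sub>t \<psi> + p \<bullet> F(x,d) \<le> 0\<close> with \<open>p = \<nabla>\<^sub>x \<psi>\<close> for
  every \<open>d \<in> D\<close>, and \<open>\<psi>\<close> does not increase along trajectories of \<open>F\<close>: along one it is absolutely continuous
  with nonpositive derivative almost everywhere. Since \<open>g\<^sub>i \<le> \<psi>\<close>, trajectories starting in
  \<open>{\<psi> \<le> 0}\<close> stay in \<open>X\<^sub>t\<close>, hence in the ball where \<open>F = f\<close>. Existence of a solution for \<open>f\<close> thus follows from
  Picard iteration for \<open>F\<close> together with Lebesgue's differentiation theorem; conversely a solution for \<open>f\<close> cannot
  leave the ball, because \<open>X\<^sub>t\<close> lies in its interior.\<close>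

text \<open>Controls are only measurable, so a trajectory is differentiable merely almost
  everywhere, and Cantor-type functions show that an almost everywhere nonpositive derivative alone
  does not prevent growth; hence the care about absolute continuity. Existence is argued for
  \<open>F\<close> because a polynomial field such as \<open>f\<close> may drive solutions to
  infinity in finite time, while a globally Lipschitz one cannot. A given solution of
  \<open>f\<close> poses a circularity: \<psi> is known not to increase only while
  \<open>F = f\<close>, that is inside the ball, and staying inside is what this monotonicity should
  yield. It is broken by continuation in time: a solution that has stayed in the closed ball up to
  time t is at that time already in its interior.\<close>

section \<open>Lebesgue differentiation of bounded functions\<close>

text \<open>Vitali covering: almost all of \<open>S\<close> is covered by disjoint balls inside an open set that exceeds
  \<open>{w \<le> p}\<close> only by a set of small measure; on these balls \<open>w\<close> has average at least \<open>q > p\<close>, which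
  their total measure must pay for.\<close>

lemma negligible_upper_density_nonneg:
  fixes w :: "'a::euclidean_space \<Rightarrow> real"
  assumes meas[measurable]: "w \<in> borel_measurable lebesgue"
    and w0: "\<And>x. 0 \<le> w x" and wM: "\<And>x. w x \<le> M"
    and pq: "0 \<le> p" "p < q" and bnd: "bounded S" and Sp: "\<And>x. x \<in> S \<Longrightarrow> w x \<le> p"
    and dens: "\<And>x e. x \<in> S \<Longrightarrow> 0 < e \<Longrightarrow> \<exists>c r. 0 < r \<and> r < e \<and> x \<in> cball c r \<and>
          ennreal q * emeasure lebesgue (cball c r) \<le> (\<integral>\<^sup>+y\<in>cball c r. ennreal (w y) \<partial>lebesgue)"
  shows "negligible S"
  unfolding negligible_outer_le
proof (intro allI impI)
  fix \<epsilon> :: real assume "0 < \<epsilon>"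
  have M0: "0 \<le> M" using w0 wM order_trans by blast
  \<comment> \<open>Chosen so that the final bound \<open>(q - p) * measure lebesgue (W \<inter> E)
    \<le> (M + 1) * \<eta>\<close> reads \<open>(q - p) * \<epsilon>\<close>; \<open>M + 1\<close>
    in place of \<open>M\<close> avoids dividing by zero.\<close>
  define \<eta> where "\<eta> = \<epsilon> * (q - p) / (M + 1)"
  have "\<eta> > 0" using \<open>0 < \<epsilon>\<close> pq M0 by (simp add: \<eta>_def)
  obtain b where "S \<subseteq> ball 0 b" using bnd bounded_subset_ballD by blast
  then have b: "S \<subseteq> cball 0 b" using ball_subset_cball by blast
  \<comment> \<open>\<open>S\<close> is not assumed measurable; \<open>E\<close> is a measurable set
    of finite measure that contains it and on which the bound by \<open>p\<close> still
    holds.\<close>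
  define E where "E = cball 0 b \<inter> {x. w x \<le> p}"
  have Emeas[measurable]: "E \<in> sets lebesgue" unfolding E_def
    using borel_measurable_le[OF meas borel_measurable_const[of p]] by auto
  have E: "E \<in> lmeasurable"
    by (rule fmeasurableI2[of "cball 0 b"]) (use Emeas in \<open>auto simp: E_def\<close>)
  obtain G where G: "open G" "E \<subseteq> G" "G - E \<in> lmeasurable" "emeasure lebesgue (G - E) < ennreal \<eta>"
    using sets_lebesgue_outer_open[OF Emeas \<open>\<eta> > 0\<close>] .
  have Glm: "G \<in> lmeasurable"
    using fmeasurable.Un[OF G(3) E] G(2) by (simp add: Un_absorb2)
  define K where "K = {(c, r). 0 < r \<and> cball c r \<subseteq> G \<and>
     ennreal q * emeasure lebesgue (cball c r) \<le> (\<integral>\<^sup>+y\<in>cball c r. ennreal (w y) \<partial>lebesgue)}"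
  have K0: "\<And>i. i \<in> K \<Longrightarrow> 0 < snd i" by (auto simp: K_def)
  have Kfine: "\<exists>i. i \<in> K \<and> x \<in> cball (fst i) (snd i) \<and> snd i < d" if "x \<in> S" "0 < d" for x d
  proof -
    have "x \<in> G" using that b Sp G(2) by (auto simp: E_def)
    then obtain k where k: "k > 0" "ball x k \<subseteq> G" using G(1) openE by blast
    \<comment> \<open>The point \<open>x\<close> need not be the centre of its ball, so the
      diameter, not the radius, has to fit into \<open>ball x k\<close>.\<close>
    have "min d (k/2) > 0" using k that by simp
    with dens[OF that(1)] obtain c r where cr: "0 < r" "r < min d (k/2)" "x \<in> cball c r"
      "ennreal q * emeasure lebesgue (cball c r) \<le> (\<integral>\<^sup>+y\<in>cball c r. ennreal (w y) \<partial>lebesgue)"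
      by blast
    have "cball c r \<subseteq> ball x k"
    proof
      fix y assume "y \<in> cball c r"
      then have "dist x y \<le> r + r" using cr(3) dist_triangle2[of x y c]
        by (simp add: dist_commute)
      then show "y \<in> ball x k" using cr(2) by simp
    qed
    then show ?thesis using cr k by (intro exI[of _ "(c,r)"]) (auto simp: K_def)
  qed
  obtain C where C: "countable C" "C \<subseteq> K"
     "pairwise (\<lambda>i j. disjnt (cball (fst i) (snd i)) (cball (fst j) (snd j))) C"
     "negligible (S - (\<Union>i \<in> C. cball (fst i) (snd i)))"
    using Vitali_covering_theorem_cballs[of K snd S fst, OF K0 Kfine] .
  define W where "W = (\<Union>i \<in> C. cball (fst i) (snd i))"
  have Wm[measurable]: "W \<in> sets lebesgue"
    unfolding W_def using C(1) by (intro sets.countable_UN') auto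
  have WG: "W \<subseteq> G" using C(2) by (fastforce simp: W_def K_def)
  have Wlm: "W \<in> lmeasurable" using fmeasurableI2[OF Glm WG] by simp
  have disj: "disjoint_family_on (\<lambda>i. cball (fst i) (snd i)) C"
    using C(3) by (auto simp: disjoint_family_on_def pairwise_def disjnt_def)
  \<comment> \<open>Read as densities, both \<open>q\<close> times the measure of \<open>W\<close>
    and the integral of \<open>w\<close> over \<open>W\<close> split along the countable disjoint
    family, which reduces their comparison to single balls.\<close>
  have UN: "emeasure (density lebesgue v) W
      = (\<integral>\<^sup>+i. emeasure (density lebesgue v) (cball (fst i) (snd i)) \<partial>count_space C)" for v
    unfolding W_def by (rule emeasure_UN_countable) (use C(1) disj in auto)
  have "ennreal q * emeasure lebesgue W = emeasure (density lebesgue (\<lambda>_. ennreal q)) W"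
    by (simp add: emeasure_density nn_integral_cmult)
  also have "\<dots> \<le> emeasure (density lebesgue (\<lambda>x. ennreal (w x))) W"
    unfolding UN
  proof (intro nn_integral_mono, unfold space_count_space)
    fix i assume "i \<in> C"
    with C(2) have "ennreal q * emeasure lebesgue (cball (fst i) (snd i))
        \<le> (\<integral>\<^sup>+y\<in>cball (fst i) (snd i). ennreal (w y) \<partial>lebesgue)"
      by (auto simp: K_def)
    then show "emeasure (density lebesgue (\<lambda>_. ennreal q)) (cball (fst i) (snd i))
       \<le> emeasure (density lebesgue (\<lambda>x. ennreal (w x))) (cball (fst i) (snd i))"
      by (subst (1 2) emeasure_density) (auto simp: nn_integral_cmult_indicator)
  qed
  also have "\<dots> = (\<integral>\<^sup>+x. ennreal (w x) * indicator W x \<partial>lebesgue)"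
    by (subst emeasure_density) auto
  also have "\<dots> \<le> (\<integral>\<^sup>+x. ennreal p * indicator (W \<inter> E) x + ennreal M * indicator (W - E) x \<partial>lebesgue)"
  proof (rule nn_integral_mono)
    fix x
    show "ennreal (w x) * indicator W x \<le> ennreal p * indicator (W \<inter> E) x + ennreal M * indicator (W - E) x"
      using wM[of x] by (auto simp: E_def indicator_def ennreal_leI)
  qed
  also have "\<dots> = ennreal p * emeasure lebesgue (W \<inter> E) + ennreal M * emeasure lebesgue (W - E)"
    by (subst nn_integral_add) (auto simp: nn_integral_cmult)
  finally have *: "ennreal q * emeasure lebesgue W
     \<le> ennreal p * emeasure lebesgue (W \<inter> E) + ennreal M * emeasure lebesgue (W - E)" .
  have WE: "W \<inter> E \<in> lmeasurable" "W - E \<in> lmeasurable"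
    using Wlm by (auto intro: fmeasurable_Int_fmeasurable fmeasurable_Diff)
  have "q * measure lebesgue W \<le> p * measure lebesgue (W \<inter> E) + M * measure lebesgue (W - E)"
    using * Wlm WE pq M0
    by (simp add: emeasure_eq_measure2 flip: ennreal_mult ennreal_plus)
  moreover have "measure lebesgue (W - E) \<le> \<eta>"
  proof -
    have "measure lebesgue (W - E) \<le> measure lebesgue (G - E)"
      by (rule measure_mono_fmeasurable) (use WG G(3) in auto)
    also have "\<dots> < \<eta>" using G(3,4) \<open>\<eta> > 0\<close> by (simp add: emeasure_eq_measure2 ennreal_less_iff)
    finally show ?thesis by simp
  qed
  moreover have "q * measure lebesgue (W \<inter> E) \<le> q * measure lebesgue W"
    using pq Wlm by (intro mult_left_mono measure_mono_fmeasurable) auto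
  ultimately have "(q - p) * measure lebesgue (W \<inter> E) \<le> M * \<eta>"
    using M0 mult_left_mono[of "measure lebesgue (W - E)" \<eta> M] by (simp add: algebra_simps)
  also have "\<dots> \<le> (M + 1) * \<eta>" using \<open>\<eta> > 0\<close> by simp
  also have "\<dots> = (q - p) * \<epsilon>" using M0 by (simp add: \<eta>_def)
  finally have small: "measure lebesgue (W \<inter> E) \<le> \<epsilon>" using pq by simp
  have null: "S - W \<in> null_sets lebesgue"
    using C(4) by (simp add: W_def negligible_iff_null_sets)
  show "\<exists>T. S \<subseteq> T \<and> T \<in> lmeasurable \<and> measure lebesgue T \<le> \<epsilon>"
  proof (intro exI conjI)
    show "S \<subseteq> (W \<inter> E) \<union> (S - W)" using b Sp by (auto simp: E_def)
    show "(W \<inter> E) \<union> (S - W) \<in> lmeasurable"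
      by (rule fmeasurable.Un[OF WE(1) fmeasurableI_null_sets[OF null]])
    show "measure lebesgue ((W \<inter> E) \<union> (S - W)) \<le> \<epsilon>"
      using small measure_Un_null_set[OF fmeasurableD[OF WE(1)] null] by simp
  qed
qed

lemma integrable_on_bounded_measurable:
  fixes u :: "'a::euclidean_space \<Rightarrow> 'b::euclidean_space"
  assumes "u \<in> borel_measurable lebesgue" "\<And>x. norm (u x) \<le> M" "S \<in> lmeasurable"
  shows "u integrable_on S"
  by (rule measurable_bounded_by_integrable_imp_integrable[of u S "\<lambda>_. M"])
     (use assms in \<open>auto intro: measurable_restrict_space1 integrable_on_const fmeasurableD\<close>)

text \<open>Adding \<open>M\<close> makes the function nonnegative and shifts \<open>p\<close>,
  \<open>q\<close> and all averages by the same amount; a point of \<open>S\<close> gives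
  \<open>0 \<le> p + M\<close>. This trades the extended nonnegative integral for the ordinary
  one.\<close>

lemma negligible_upper_density:
  fixes u :: "'a::euclidean_space \<Rightarrow> real"
  assumes meas: "u \<in> borel_measurable lebesgue" and uM: "\<And>x. \<bar>u x\<bar> \<le> M"
    and "p < q" and bnd: "bounded S" and Sp: "\<And>x. x \<in> S \<Longrightarrow> u x \<le> p"
    and dens: "\<And>x e. x \<in> S \<Longrightarrow> 0 < e \<Longrightarrow> \<exists>c r. 0 < r \<and> r < e \<and> x \<in> cball c r \<and>
          q * measure lebesgue (cball c r) \<le> integral (cball c r) u"
  shows "negligible S"
proof (cases "S = {}")
  case False
  then obtain x0 where "x0 \<in> S" by blast
  with Sp uM[of x0] have p: "0 \<le> p + M" by fastforce
  show ?thesis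
  proof (rule negligible_upper_density_nonneg[where w = "\<lambda>x. u x + M" and M = "2 * M" and p = "p + M" and q = "q + M"])
    show "(\<lambda>x. u x + M) \<in> borel_measurable lebesgue" using meas by simp
    show "0 \<le> u x + M" "u x + M \<le> 2 * M" for x using uM[of x] by auto
    show "u x + M \<le> p + M" if "x \<in> S" for x using Sp[OF that] by simp
    fix x and e :: real assume "x \<in> S" "0 < e"
    from dens[OF this] obtain c r where cr: "0 < r" "r < e" "x \<in> cball c r"
          "q * measure lebesgue (cball c r) \<le> integral (cball c r) u" by blast
    have u0: "0 \<le> u y + M" for y using uM[of y] by linarith
    have lm: "cball c r \<in> lmeasurable" by simp
    have ui: "u integrable_on cball c r"
      using integrable_on_bounded_measurable[OF meas _ lm, of M] uM by simp
    have "((\<lambda>x. u x + M) has_integral integral (cball c r) u + M * measure lebesgue (cball c r)) (cball c r)"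
    proof (rule has_integral_add)
      show "((\<lambda>x. M) has_integral M * measure lebesgue (cball c r)) (cball c r)"
        using has_integral_mult_right[OF lmeasurable_iff_indicator_has_integral[THEN iffD1, OF conjI[OF lm refl]], of M]
        unfolding has_integral_restrict_UNIV[of "cball c r" "\<lambda>x. M", symmetric]
        by (auto simp: indicator_def of_bool_def if_distrib cong: if_cong)
    qed (use ui in blast)
    then have "(\<integral>\<^sup>+y\<in>cball c r. ennreal (u y + M) \<partial>lborel)
      = ennreal (integral (cball c r) u + M * measure lebesgue (cball c r))"
      by (intro nn_integral_has_integral_lebesgue') (simp_all add: u0)
    moreover have "ennreal (q + M) * emeasure lebesgue (cball c r)
       \<le> ennreal (integral (cball c r) u + M * measure lebesgue (cball c r))"
      using cr(4) p \<open>p < q\<close> by (simp add: emeasure_eq_measure2 algebra_simps ennreal_leI flip: ennreal_mult)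
    ultimately show "\<exists>c r. 0 < r \<and> r < e \<and> x \<in> cball c r \<and> ennreal (q + M) * emeasure lebesgue (cball c r)
       \<le> (\<integral>\<^sup>+y\<in>cball c r. ennreal (u y + M) \<partial>lebesgue)"
      using cr(1-3) by (metis nn_integral_completion)
  qed (use p assms in auto)
qed simp

text \<open>Where averages over small intervals around \<open>t\<close> fail to be eventually below
  \<open>u t + e\<close>, rationals \<open>p < q\<close> separate \<open>u t\<close> from averages
  over arbitrarily short intervals, so \<open>t\<close> lies in one of countably many negligible
  sets. The same for \<open>- u\<close> bounds the averages from below.\<close>

lemma integral_has_real_derivative_ae:
  fixes u :: "real \<Rightarrow> real"
  assumes meas: "u \<in> borel_measurable lebesgue" and uM: "\<And>x. \<bar>u x\<bar> \<le> M"
  shows "\<exists>N. negligible N \<and> (\<forall>t\<in>{a<..<b} - N. ((\<lambda>s. integral {a..s} u) has_real_derivative u t) (at t))"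
proof -
  define bad where "bad v p q = {t \<in> {a<..<b}. v t \<le> p \<and>
      (\<forall>e>0. \<exists>c r. 0 < r \<and> r < e \<and> t \<in> cball c r \<and> q * (2 * r) \<le> integral (cball c r) v)}"
    for v :: "real \<Rightarrow> real" and p q
  define Q where "Q = {(p, q). p \<in> \<rat> \<and> q \<in> \<rat> \<and> p < (q::real)}"
  have neg: "negligible (bad v p q)"
    if v: "v \<in> borel_measurable lebesgue" "\<And>x. \<bar>v x\<bar> \<le> M" and "p < q" for v p q
  proof (rule negligible_upper_density[OF v \<open>p < q\<close>])
    show "bounded (bad v p q)"
      by (rule bounded_subset[of "{a<..<b}"]) (auto simp: bad_def)
    show "v x \<le> p" if "x \<in> bad v p q" for x using that by (simp add: bad_def)
    fix x e :: real assume "x \<in> bad v p q" "0 < e"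
    then obtain c r where "0 < r" "r < e" "x \<in> cball c r" "q * (2 * r) \<le> integral (cball c r) v"
      unfolding bad_def by blast
    then show "\<exists>c r. 0 < r \<and> r < e \<and> x \<in> cball c r \<and> q * measure lebesgue (cball c r) \<le> integral (cball c r) v"
      by (intro exI[of _ c] exI[of _ r]) (simp add: cball_eq_atLeastAtMost)
  qed
  define N where "N = (\<Union>(p, q)\<in>Q. bad u p q \<union> bad (\<lambda>x. - u x) p q)"
  have "countable Q"
    by (rule countable_subset[of _ "\<rat> \<times> \<rat>"]) (auto simp: Q_def countable_rat)
  have negN: "negligible N"
    unfolding N_def
  proof (rule negligible_countable_Union)
    show "countable ((\<lambda>(p, q). bad u p q \<union> bad (\<lambda>x. - u x) p q) ` Q)" using \<open>countable Q\<close> by simp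
  qed (use meas uM in \<open>auto simp: Q_def intro!: neg negligible_Un\<close>)
  \<comment> \<open>The intervals may contain \<open>t\<close> anywhere, also as an end point, so
    this one estimate serves both the left and the right difference quotient.\<close>
  have upper: "\<exists>d>0. \<forall>x y. x \<le> t \<longrightarrow> t \<le> y \<longrightarrow> x < y \<longrightarrow> y - x < d \<longrightarrow> integral {x..y} v \<le> (v t + e) * (y - x)"
    if t: "t \<in> {a<..<b} - N" and e: "0 < e" and v: "v = u \<or> v = (\<lambda>x. - u x)" for t e v
  proof -
    obtain p where p: "p \<in> \<rat>" "v t < p" "p < v t + e" using Rats_dense_in_real[of "v t" "v t + e"] e by auto
    obtain q where q: "q \<in> \<rat>" "p < q" "q < v t + e" using Rats_dense_in_real[of p "v t + e"] p by auto
    have "(p, q) \<in> Q" using p q by (simp add: Q_def)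
    then have "t \<notin> bad v p q" using t v by (auto simp: N_def)
    then have "\<not> (\<forall>e>0. \<exists>c r. 0 < r \<and> r < e \<and> t \<in> cball c r \<and> q * (2 * r) \<le> integral (cball c r) v)"
      using t p(2) unfolding bad_def by auto
    then obtain d where d: "0 < d" "\<And>c r. 0 < r \<Longrightarrow> r < d \<Longrightarrow> t \<in> cball c r \<Longrightarrow> integral (cball c r) v < q * (2 * r)"
      by (meson not_le)
    show ?thesis
    proof (intro exI[of _ "2 * d"] conjI allI impI)
      show "0 < 2 * d" using d by simp
      fix x y assume xy: "x \<le> t" "t \<le> y" "x < y" "y - x < 2 * d"
      have cb: "cball ((x + y) / 2) ((y - x) / 2) = {x..y}"
        by (simp add: cball_eq_atLeastAtMost field_simps)
      have "integral {x..y} v < q * (2 * ((y - x) / 2))"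
        using d(2)[of "(y - x) / 2" "(x + y) / 2"] xy unfolding cb by auto
      also have "\<dots> = q * (y - x)" by simp
      also have "\<dots> \<le> (v t + e) * (y - x)" using q xy by (intro mult_right_mono) auto
      finally show "integral {x..y} v \<le> (v t + e) * (y - x)" by simp
    qed
  qed
  have int: "u integrable_on {x..y}" for x y
    using integrable_on_bounded_measurable[OF meas, of M "{x..y}"] uM by simp
  have "((\<lambda>s. integral {a..s} u) has_real_derivative u t) (at t)" if t: "t \<in> {a<..<b} - N" for t
    unfolding has_field_derivative_def has_derivative_within_alt
  proof (intro conjI allI impI)
    show "bounded_linear ((*) (u t))" by (rule bounded_linear_mult_right)
    fix e :: real assume "0 < e"
    obtain d1 where d1: "d1 > 0" "\<And>x y. x \<le> t \<Longrightarrow> t \<le> y \<Longrightarrow> x < y \<Longrightarrow> y - x < d1 \<Longrightarrow> integral {x..y} u \<le> (u t + e) * (y - x)"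
      using upper[OF t \<open>0 < e\<close>, of u] by auto
    obtain d2 where d2: "d2 > 0" "\<And>x y. x \<le> t \<Longrightarrow> t \<le> y \<Longrightarrow> x < y \<Longrightarrow> y - x < d2 \<Longrightarrow> integral {x..y} (\<lambda>x. - u x) \<le> (- u t + e) * (y - x)"
      using upper[OF t \<open>0 < e\<close>, of "\<lambda>x. - u x"] by auto
    have est: "\<bar>integral {x..y} u - u t * (y - x)\<bar> \<le> e * (y - x)"
      if "x \<le> t" "t \<le> y" "x < y" "y - x < min d1 d2" for x y
      using d1(2)[of x y] d2(2)[of x y] that by (simp add: abs_le_iff algebra_simps)
    show "\<exists>d>0. \<forall>y\<in>UNIV. norm (y - t) < d \<longrightarrow>
       norm (integral {a..y} u - integral {a..t} u - u t * (y - t)) \<le> e * norm (y - t)"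
    \<comment> \<open>The term \<open>t - a\<close> keeps \<open>y\<close> to the right of
      \<open>a\<close>, where the integral from \<open>a\<close> can be split at
      \<open>y\<close>.\<close>
    proof (intro exI[of _ "min (min d1 d2) (t - a)"] conjI ballI impI)
      show "0 < min (min d1 d2) (t - a)" using d1 d2 t by auto
      fix y assume y: "norm (y - t) < min (min d1 d2) (t - a)"
      consider "y = t" | "t < y" | "y < t" by linarith
      then show "norm (integral {a..y} u - integral {a..t} u - u t * (y - t)) \<le> e * norm (y - t)"
      proof cases
        case 2
        have "integral {a..t} u + integral {t..y} u = integral {a..y} u"
          using t 2 by (intro Henstock_Kurzweil_Integration.integral_combine int) auto
        then show ?thesis using est[of t y] 2 y by (simp add: algebra_simps)
      next
        case 3
        have "integral {a..y} u + integral {y..t} u = integral {a..t} u"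
          using t 3 y by (intro Henstock_Kurzweil_Integration.integral_combine int) auto
        then show ?thesis using est[of y t] 3 y by (simp add: abs_le_iff algebra_simps)
      qed simp
    qed
  qed
  then show ?thesis using negN by blast
qed

text \<open>The real case is applied to each coordinate of the extension of \<open>u\<close> by
  zero. It covers only the open interval, so both end points are added to the exceptional
  set.\<close>

theorem indefinite_integral_has_vector_derivative_ae:
  fixes u :: "real \<Rightarrow> 'a::euclidean_space"
  assumes meas: "u \<in> borel_measurable (lebesgue_on {a..b})" and uM: "\<And>x. x \<in> {a..b} \<Longrightarrow> norm (u x) \<le> M"
  shows "\<exists>N. negligible N \<and>
    (\<forall>t\<in>{a..b} - N. ((\<lambda>s. integral {a..s} u) has_vector_derivative u t) (at t within {a..b}))"
proof -
  define v where "v x = (if x \<in> {a..b} then u x else 0)" for x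
  have vm: "v \<in> borel_measurable lebesgue"
    unfolding v_def using borel_measurable_if[of "{a..b}" u] meas by simp
  have vM: "norm (v x) \<le> \<bar>M\<bar>" for x using uM[of x] by (auto simp: v_def)
  have "\<forall>i\<in>Basis. \<exists>N. negligible N \<and>
      (\<forall>t\<in>{a<..<b} - N. ((\<lambda>s. integral {a..s} (\<lambda>x. v x \<bullet> i)) has_real_derivative v t \<bullet> i) (at t))"
  proof
    fix i :: 'a assume i: "i \<in> Basis"
    show "\<exists>N. negligible N \<and>
      (\<forall>t\<in>{a<..<b} - N. ((\<lambda>s. integral {a..s} (\<lambda>x. v x \<bullet> i)) has_real_derivative v t \<bullet> i) (at t))"
    proof (rule integral_has_real_derivative_ae)
      show "(\<lambda>x. v x \<bullet> i) \<in> borel_measurable lebesgue" using vm by simp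
      show "\<bar>v x \<bullet> i\<bar> \<le> \<bar>M\<bar>" for x using vM[of x] Basis_le_norm[OF i, of "v x"] by simp
    qed
  qed
  then obtain N where N: "\<And>i. i \<in> Basis \<Longrightarrow> negligible (N i)"
    "\<And>i t. i \<in> Basis \<Longrightarrow> t \<in> {a<..<b} - N i \<Longrightarrow>
       ((\<lambda>s. integral {a..s} (\<lambda>x. v x \<bullet> i)) has_real_derivative v t \<bullet> i) (at t)"
    by metis
  have eq: "integral {a..s} (\<lambda>x. v x \<bullet> i) = integral {a..s} u \<bullet> i" if "s \<in> {a..b}" "i \<in> Basis" for s i
  proof -
    have vi: "v integrable_on {a..s}"
      using integrable_on_bounded_measurable[OF vm vM, of "{a..s}"] by simp
    have "integral {a..s} (\<lambda>x. v x \<bullet> i) = integral {a..s} v \<bullet> i"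
      using integral_component_eq[OF vi] by simp
    also have "integral {a..s} v = integral {a..s} u"
      using that by (intro integral_cong) (auto simp: v_def)
    finally show ?thesis .
  qed
  show ?thesis
  proof (intro exI[of _ "(\<Union>i\<in>Basis. N i) \<union> {a, b}"] conjI ballI)
    show "negligible ((\<Union>i\<in>Basis. N i) \<union> {a, b})"
      using N(1) by (intro negligible_Un negligible_Union) auto
    fix t assume t: "t \<in> {a..b} - ((\<Union>i\<in>Basis. N i) \<union> {a, b})"
    show "((\<lambda>s. integral {a..s} u) has_vector_derivative u t) (at t within {a..b})"
      unfolding has_vector_derivative_def
    proof (subst has_derivative_componentwise_within, intro ballI)
      fix i :: 'a assume i: "i \<in> Basis"
      have "((\<lambda>s. integral {a..s} (\<lambda>x. v x \<bullet> i)) has_derivative (*) (v t \<bullet> i)) (at t within {a..b})"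
        using N(2)[OF i, of t] t i by (auto simp: has_field_derivative_def intro: has_derivative_at_withinI)
      then have "((\<lambda>s. integral {a..s} u \<bullet> i) has_derivative (*) (v t \<bullet> i)) (at t within {a..b})"
        by (rule has_derivative_transform[rotated 2]) (use t eq i in auto)
      moreover have "(*) (v t \<bullet> i) = (\<lambda>x. x *\<^sub>R u t \<bullet> i)" using t by (auto simp: v_def fun_eq_iff)
      ultimately show "((\<lambda>s. integral {a..s} u \<bullet> i) has_derivative (\<lambda>x. x *\<^sub>R u t \<bullet> i)) (at t within {a..b})"
        by simp
    qed
  qed
qed

section \<open>Absolutely continuous functions\<close>

lemma abs_continuous_on_intervalD:
  assumes "abs_continuous_on_interval a b y" "0 < e"
  shows "\<exists>\<delta>>0. \<forall>I. I division_of (\<Union>I) \<and> \<Union>I \<subseteq> {a..b} \<and>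
        (\<Sum>k\<in>I. Sup k - Inf k) < \<delta> \<longrightarrow> (\<Sum>k\<in>I. norm (y (Sup k) - y (Inf k))) < e"
  using assms unfolding abs_continuous_on_interval_def by meson

lemma abs_continuous_on_interval_subset:
  assumes "abs_continuous_on_interval a b y" "{c..d} \<subseteq> {a..b}"
  shows "abs_continuous_on_interval c d y"
  using assms unfolding abs_continuous_on_interval_def by (meson order_trans)

lemma abs_continuous_on_interval_lipschitz:
  assumes "L-lipschitz_on {a..b} y"
  shows "abs_continuous_on_interval a b y"
  unfolding abs_continuous_on_interval_def
proof (intro allI impI)
  fix e :: real assume "0 < e"
  have L: "0 \<le> L" using assms lipschitz_on_nonneg by blast
  show "\<exists>\<delta>>0. \<forall>I. I division_of (\<Union>I) \<longrightarrow> \<Union>I \<subseteq> {a..b} \<longrightarrow>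
        (\<Sum>k\<in>I. Sup k - Inf k) < \<delta> \<longrightarrow> (\<Sum>k\<in>I. norm (y (Sup k) - y (Inf k))) < e"
  proof (intro exI[of _ "e / (L + 1)"] conjI allI impI)
    show "0 < e / (L + 1)" using \<open>0 < e\<close> L by simp
    fix I assume I: "I division_of (\<Union>I)" "\<Union>I \<subseteq> {a..b}" "(\<Sum>k\<in>I. Sup k - Inf k) < e / (L + 1)"
    have k: "Inf k \<le> Sup k \<and> norm (y (Sup k) - y (Inf k)) \<le> (L + 1) * (Sup k - Inf k)" if kI: "k \<in> I" for k
    proof -
      obtain u v where uv: "k = {u..v}" "k \<noteq> {}" using division_ofD(3,4)[OF I(1) kI] by auto
      then have "u \<le> v" "{u..v} \<subseteq> {a..b}" using I(2) kI by (auto simp del: atLeastatMost_subset_iff)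
      then have "u \<in> {a..b}" "v \<in> {a..b}" by auto
      then have "norm (y v - y u) \<le> L * (v - u)"
        using lipschitz_onD[OF assms, of v u] \<open>u \<le> v\<close> by (simp add: dist_norm)
      then show ?thesis using uv \<open>u \<le> v\<close> by (simp add: algebra_simps)
    qed
    have "(\<Sum>k\<in>I. norm (y (Sup k) - y (Inf k))) \<le> (L + 1) * (\<Sum>k\<in>I. Sup k - Inf k)"
      unfolding sum_distrib_left using k by (intro sum_mono) auto
    also have "\<dots> < e" using I(3) L by (simp add: field_simps)
    finally show "(\<Sum>k\<in>I. norm (y (Sup k) - y (Inf k))) < e" .
  qed
qed

lemma abs_continuous_on_interval_continuous_on:
  assumes "abs_continuous_on_interval a b y"
  shows "continuous_on {a..b} y"
  unfolding continuous_on_iff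
proof (intro ballI allI impI)
  fix x e assume x: "x \<in> {a..b}" and "(0::real) < e"
  obtain \<delta> where \<delta>: "0 < \<delta>" "\<forall>I. I division_of (\<Union>I) \<and> \<Union>I \<subseteq> {a..b} \<and>
        (\<Sum>k\<in>I. Sup k - Inf k) < \<delta> \<longrightarrow> (\<Sum>k\<in>I. norm (y (Sup k) - y (Inf k))) < e"
    using abs_continuous_on_intervalD[OF assms \<open>0 < e\<close>] by (elim exE conjE)
  have *: "norm (y v - y u) < e" if "u \<le> v" "v - u < \<delta>" "u \<in> {a..b}" "v \<in> {a..b}" for u v
  proof -
    have "{{u..v}} division_of {u..v}"
      using division_of_self[of u v] that by simp
    then show ?thesis using \<delta>(2)[rule_format, of "{{u..v}}"] that by auto
  qed
  show "\<exists>d>0. \<forall>x'\<in>{a..b}. dist x' x < d \<longrightarrow> dist (y x') (y x) < e"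
  proof (intro exI[of _ \<delta>] conjI ballI impI \<delta>(1))
    fix x' assume x': "x' \<in> {a..b}" "dist x' x < \<delta>"
    then show "dist (y x') (y x) < e"
      using *[of x x'] *[of x' x] x by (cases "x \<le> x'") (auto simp: dist_norm norm_minus_commute dist_real_def)
  qed
qed

lemma abs_continuous_on_interval_compose_lipschitz:
  assumes y: "abs_continuous_on_interval a b y" and "C-lipschitz_on S v" "y ` {a..b} \<subseteq> S"
  shows "abs_continuous_on_interval a b (\<lambda>s. v (y s))"
  unfolding abs_continuous_on_interval_def
proof (intro allI impI)
  fix e :: real assume "0 < e"
  have C: "0 \<le> C" using assms lipschitz_on_nonneg by blast
  then have e': "0 < e / (C + 1)" using \<open>0 < e\<close> by simp
  obtain \<delta> where \<delta>: "0 < \<delta>" "\<forall>I. I division_of (\<Union>I) \<and> \<Union>I \<subseteq> {a..b} \<and>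
        (\<Sum>k\<in>I. Sup k - Inf k) < \<delta> \<longrightarrow> (\<Sum>k\<in>I. norm (y (Sup k) - y (Inf k))) < e / (C + 1)"
    using abs_continuous_on_intervalD[OF y e'] by (elim exE conjE)
  show "\<exists>\<delta>>0. \<forall>I. I division_of (\<Union>I) \<longrightarrow> \<Union>I \<subseteq> {a..b} \<longrightarrow>
        (\<Sum>k\<in>I. Sup k - Inf k) < \<delta> \<longrightarrow> (\<Sum>k\<in>I. norm (v (y (Sup k)) - v (y (Inf k)))) < e"
  proof (intro exI[of _ \<delta>] conjI allI impI \<delta>(1))
    fix I assume I: "I division_of (\<Union>I)" "\<Union>I \<subseteq> {a..b}" "(\<Sum>k\<in>I. Sup k - Inf k) < \<delta>"
    have k: "norm (v (y (Sup k)) - v (y (Inf k))) \<le> (C + 1) * norm (y (Sup k) - y (Inf k))" if kI: "k \<in> I" for k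
    proof -
      obtain s t where st: "k = {s..t}" "k \<noteq> {}" using division_ofD(3,4)[OF I(1) kI] by auto
      then have "s \<le> t" "{s..t} \<subseteq> {a..b}" using I(2) kI by (auto simp del: atLeastatMost_subset_iff)
      then have "s \<in> {a..b}" "t \<in> {a..b}" by auto
      then have "norm (v (y t) - v (y s)) \<le> C * norm (y t - y s)"
        using lipschitz_onD[OF assms(2), of "y t" "y s"] assms(3) by (simp add: dist_norm image_subset_iff)
      then show ?thesis using st \<open>s \<le> t\<close> by (simp add: distrib_right add_increasing2)
    qed
    have "(\<Sum>k\<in>I. norm (v (y (Sup k)) - v (y (Inf k)))) \<le> (C + 1) * (\<Sum>k\<in>I. norm (y (Sup k) - y (Inf k)))"
      unfolding sum_distrib_left using k by (intro sum_mono) auto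
    also have "\<dots> < e" using \<delta>(2)[rule_format, OF conjI[OF I(1) conjI[OF I(2,3)]]] C by (simp add: field_simps)
    finally show "(\<Sum>k\<in>I. norm (v (y (Sup k)) - v (y (Inf k)))) < e" .
  qed
qed

text \<open>Lifts a trajectory to a curve in space-time, so that a function of position and time
  along it becomes a composition with a Lipschitz function.\<close>

lemma abs_continuous_on_interval_Pair_id:
  fixes y :: "real \<Rightarrow> 'a::real_normed_vector"
  assumes y: "abs_continuous_on_interval a b y"
  shows "abs_continuous_on_interval a b (\<lambda>s. (y s, s))"
  unfolding abs_continuous_on_interval_def
proof (intro allI impI)
  fix e :: real assume "0 < e"
  then have e': "0 < e / 2" by simp
  obtain \<delta> where \<delta>: "0 < \<delta>" "\<forall>I. I division_of (\<Union>I) \<and> \<Union>I \<subseteq> {a..b} \<and>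
        (\<Sum>k\<in>I. Sup k - Inf k) < \<delta> \<longrightarrow> (\<Sum>k\<in>I. norm (y (Sup k) - y (Inf k))) < e / 2"
    using abs_continuous_on_intervalD[OF y e'] by (elim exE conjE)
  show "\<exists>\<delta>>0. \<forall>I. I division_of (\<Union>I) \<longrightarrow> \<Union>I \<subseteq> {a..b} \<longrightarrow>
        (\<Sum>k\<in>I. Sup k - Inf k) < \<delta> \<longrightarrow> (\<Sum>k\<in>I. norm ((y (Sup k), Sup k) - (y (Inf k), Inf k))) < e"
  proof (intro exI[of _ "min \<delta> (e/2)"] conjI allI impI)
    show "0 < min \<delta> (e/2)" using \<delta>(1) \<open>0 < e\<close> by simp
    fix I assume I: "I division_of (\<Union>I)" "\<Union>I \<subseteq> {a..b}" "(\<Sum>k\<in>I. Sup k - Inf k) < min \<delta> (e/2)"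
    have k: "norm ((y (Sup k), Sup k) - (y (Inf k), Inf k)) \<le> norm (y (Sup k) - y (Inf k)) + (Sup k - Inf k)"
      if kI: "k \<in> I" for k
    proof -
      obtain s t where st: "k = {s..t}" "k \<noteq> {}" using division_ofD(3,4)[OF I(1) kI] by auto
      have "norm (y t - y s, t - s) \<le> norm (y t - y s) + norm (t - s)"
        by (rule norm_Pair_le)
      then show ?thesis using st by simp
    qed
    have "(\<Sum>k\<in>I. norm ((y (Sup k), Sup k) - (y (Inf k), Inf k)))
       \<le> (\<Sum>k\<in>I. norm (y (Sup k) - y (Inf k))) + (\<Sum>k\<in>I. Sup k - Inf k)"
      unfolding sum.distrib[symmetric] by (intro sum_mono k)
    also have "\<dots> < e" using \<delta>(2)[rule_format, of I] I by simp
    finally show "(\<Sum>k\<in>I. norm ((y (Sup k), Sup k) - (y (Inf k), Inf k))) < e" .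
  qed
qed

text \<open>Both end points are compared with \<open>s\<close>. Since \<open>s\<close> lies between
  them, the errors \<open>e * (s - u)\<close> and \<open>e * (v - s)\<close> add up to exactly
  \<open>e * (v - u)\<close>, however unevenly \<open>s\<close> divides the interval.\<close>

lemma has_real_derivative_nonpos_straddle:
  fixes \<phi> :: "real \<Rightarrow> real"
  assumes "(\<phi> has_real_derivative D) (at s within A)" "D \<le> 0" "0 < e" "s \<in> A"
  obtains d where "0 < d" "\<And>u v. u \<in> A \<Longrightarrow> v \<in> A \<Longrightarrow> u \<le> s \<Longrightarrow> s \<le> v \<Longrightarrow> \<bar>u - s\<bar> < d \<Longrightarrow> \<bar>v - s\<bar> < d \<Longrightarrow>
      \<phi> v - \<phi> u \<le> e * (v - u)"
proof -
  have "(\<phi> has_derivative (\<lambda>h. D * h)) (at s within A)"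
    using assms(1) by (simp add: has_field_derivative_def)
  then obtain d where d: "0 < d" "\<And>y. y \<in> A \<Longrightarrow> norm (y - s) < d \<Longrightarrow> norm (\<phi> y - \<phi> s - D * (y - s)) \<le> e * norm (y - s)"
    using assms(3) unfolding has_derivative_within_alt by metis
  show thesis
  proof (rule that[OF d(1)])
    fix u v assume uv: "u \<in> A" "v \<in> A" "u \<le> s" "s \<le> v" "\<bar>u - s\<bar> < d" "\<bar>v - s\<bar> < d"
    have "\<bar>\<phi> u - \<phi> s - D * (u - s)\<bar> \<le> e * (s - u)" "\<bar>\<phi> v - \<phi> s - D * (v - s)\<bar> \<le> e * (v - s)"
      using d(2)[of u] d(2)[of v] uv by auto
    then have "\<phi> v - \<phi> u \<le> e * (v - u) + D * (v - u)" by (simp add: algebra_simps abs_le_iff)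
    moreover have "D * (v - u) \<le> 0" using assms(2) uv by (simp add: mult_nonpos_nonneg)
    ultimately show "\<phi> v - \<phi> u \<le> e * (v - u)" by simp
  qed
qed

text \<open>Cousin's lemma for a gauge that follows the derivative off \<open>N\<close> and keeps the intervals tagged
  in \<open>N\<close> inside an open set so small that absolute continuity controls their increments.\<close>

lemma abs_continuous_nonincreasing:
  fixes \<phi> :: "real \<Rightarrow> real"
  assumes ac: "abs_continuous_on_interval a b \<phi>" and ab: "a \<le> b" and N: "negligible N"
    and der: "\<And>s. s \<in> {a..b} - N \<Longrightarrow> \<exists>D\<le>0. (\<phi> has_real_derivative D) (at s within {a..b})"
  shows "\<phi> b \<le> \<phi> a"
proof (rule field_le_epsilon)
  fix e0 :: real assume "0 < e0"
  \<comment> \<open>Intervals tagged off \<open>N\<close> contribute at most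
    \<open>e * (b - a)\<close> in total and those tagged in \<open>N\<close> less than
    \<open>e\<close> more; together this is \<open>e0\<close>.\<close>
  define e where "e = e0 / (b - a + 1)"
  have "0 < e" "e * (b - a + 1) = e0"
    using \<open>0 < e0\<close> ab by (auto simp: e_def)
  then have e: "0 < e" "e * (b - a) + e = e0" by (auto simp: distrib_left)
  obtain \<delta> where \<delta>: "0 < \<delta>" "\<forall>I. I division_of (\<Union>I) \<and> \<Union>I \<subseteq> {a..b} \<and>
        (\<Sum>k\<in>I. Sup k - Inf k) < \<delta> \<longrightarrow> (\<Sum>k\<in>I. norm (\<phi> (Sup k) - \<phi> (Inf k))) < e"
    using abs_continuous_on_intervalD[OF ac e(1)] by (elim exE conjE)
  have Nm: "N \<in> sets lebesgue" using N by (rule negligible_imp_sets)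
  obtain G where G: "open G" "N \<subseteq> G" "G - N \<in> lmeasurable" "emeasure lebesgue (G - N) < ennreal \<delta>"
    using sets_lebesgue_outer_open[OF Nm \<delta>(1)] .
  have Glm: "G \<in> lmeasurable" and Gm: "measure lebesgue G < \<delta>"
  proof -
    have "G = (G - N) \<union> N" using G(2) by blast
    then show "G \<in> lmeasurable"
      using fmeasurable.Un[OF G(3) negligible_imp_measurable[OF N]] by simp
    have "measure lebesgue (G - N) = measure lebesgue G"
      using \<open>G \<in> lmeasurable\<close> N by (simp add: measure_Diff_null_set negligible_iff_null_sets fmeasurableD)
    then show "measure lebesgue G < \<delta>"
      using G(3,4) \<delta>(1) by (simp add: emeasure_eq_measure2 ennreal_less_iff)
  qed
  have "\<exists>d>0. (s \<in> N \<longrightarrow> ball s d \<subseteq> G) \<and>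
     (s \<in> {a..b} - N \<longrightarrow> (\<forall>u v. u \<in> {a..b} \<longrightarrow> v \<in> {a..b} \<longrightarrow> u \<le> s \<longrightarrow> s \<le> v \<longrightarrow> \<bar>u - s\<bar> < d \<longrightarrow> \<bar>v - s\<bar> < d \<longrightarrow>
      \<phi> v - \<phi> u \<le> e * (v - u)))" for s
  proof (cases "s \<in> {a..b} - N")
    case True
    with der obtain D where "D \<le> 0" "(\<phi> has_real_derivative D) (at s within {a..b})" by blast
    then show ?thesis using has_real_derivative_nonpos_straddle[of \<phi> D s "{a..b}" e] e(1) True
      by (metis DiffE)
  next
    case False
    then show ?thesis
      by (cases "s \<in> N") (use G(1,2) openE in \<open>blast, use zero_less_one in blast\<close>)
  qed
  then obtain d where d: "\<And>s. 0 < d s" "\<And>s. s \<in> N \<Longrightarrow> ball s (d s) \<subseteq> G"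
    "\<And>s u v. s \<in> {a..b} - N \<Longrightarrow> u \<in> {a..b} \<Longrightarrow> v \<in> {a..b} \<Longrightarrow> u \<le> s \<Longrightarrow> s \<le> v \<Longrightarrow> \<bar>u - s\<bar> < d s \<Longrightarrow> \<bar>v - s\<bar> < d s \<Longrightarrow>
      \<phi> v - \<phi> u \<le> e * (v - u)"
    by metis
  have "gauge (\<lambda>s. ball s (d s))" using d(1) by (intro gauge_ball_dependent) auto
  then obtain p where p: "p tagged_division_of {a..b}" "(\<lambda>s. ball s (d s)) fine p"
    using fine_division_exists_real by blast
  note pD = tagged_division_ofD[OF p(1)]
  have box: "\<exists>u v. k = {u..v} \<and> u \<le> x \<and> x \<le> v \<and> u \<in> {a..b} \<and> v \<in> {a..b} \<and> \<bar>u - x\<bar> < d x \<and> \<bar>v - x\<bar> < d x \<and> k \<subseteq> ball x (d x)"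
    if xk: "(x, k) \<in> p" for x k
  proof -
    obtain u v where uv: "k = {u..v}" using pD(4)[OF xk] by auto
    have x: "x \<in> {u..v}" using pD(2)[OF xk] uv by simp
    have "{u..v} \<subseteq> {a..b}" using pD(3)[OF xk] uv by simp
    moreover have kb: "{u..v} \<subseteq> ball x (d x)" using fineD[OF p(2) xk] uv by simp
    moreover have "u \<in> {u..v}" "v \<in> {u..v}" using x by auto
    ultimately have "u \<in> {a..b}" "v \<in> {a..b}" "u \<in> ball x (d x)" "v \<in> ball x (d x)" by blast+
    then show ?thesis using uv x kb by (auto simp: dist_real_def abs_minus_commute)
  qed
  define q where "q = {(x, k) \<in> p. x \<in> N}"
  have qp: "q \<subseteq> p" by (auto simp: q_def)
  have fp: "finite p" using pD(1) .
  have qt: "q tagged_partial_division_of {a..b}"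
    using tagged_partial_division_subset[OF _ qp] p(1) by (simp add: tagged_division_of_def)
  note qdiv = partial_division_of_tagged_division[OF qt]
  have fI: "finite (snd ` q)" using qdiv by blast
  have lm: "k \<in> lmeasurable \<and> Sup k - Inf k = measure lebesgue k" if kq: "k \<in> snd ` q" for k
  proof -
    obtain x where "(x, k) \<in> p" using kq qp by auto
    then obtain u v where "k = {u..v}" "u \<le> x" "x \<le> v" using box by blast
    then show ?thesis by simp
  qed
  \<comment> \<open>As the intervals do not overlap and lie in \<open>G\<close>, their total length
    is at most the measure of \<open>G\<close>, below the threshold of absolute continuity.\<close>
  have "(\<Sum>k\<in>snd ` q. Sup k - Inf k) = (\<Sum>k\<in>snd ` q. measure lebesgue k)"
    using lm by (intro sum.cong) simp_all
  also have "\<dots> = measure lebesgue (\<Union>(snd ` q))"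
    using content_division[OF qdiv] by simp
  also have "\<dots> \<le> measure lebesgue G"
  proof (rule measure_mono_fmeasurable)
    show "\<Union> (snd ` q) \<subseteq> G"
    proof -
      have "k \<subseteq> G" if "(x, k) \<in> q" for x k
        using box[of x k] d(2)[of x] that by (auto simp: q_def)
      then show ?thesis by fastforce
    qed
    show "\<Union> (snd ` q) \<in> sets lebesgue"
      by (rule sets.finite_Union[OF fI]) (use lm fmeasurableD in blast)
  qed (rule Glm)
  also note Gm
  finally have len: "(\<Sum>k\<in>snd ` q. Sup k - Inf k) < \<delta>" .
  have "k \<subseteq> {a..b}" if "(x, k) \<in> q" for x k using pD(3) qp that by blast
  then have sub: "\<Union>(snd ` q) \<subseteq> {a..b}" by fastforce
  have qsum: "(\<Sum>k\<in>snd ` q. norm (\<phi> (Sup k) - \<phi> (Inf k))) < e"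
    by (rule \<delta>(2)[rule_format, OF conjI[OF qdiv conjI[OF sub len]]])
  \<comment> \<open>Two tags can share an interval only if it is degenerate. Passing from a sum over
    tags to one over intervals thus needs a summand vanishing on boxes with empty interior,
    including the empty set, where \<open>Sup\<close> and \<open>Inf\<close> carry no
    information.\<close>
  let ?inc = "\<lambda>k. if k = {} then 0 else norm (\<phi> (Sup k) - \<phi> (Inf k))"
  have ne: "k \<noteq> {}" if "(x, k) \<in> q" for x k
    using pD(2)[of x k] qp that by auto
  have "(\<Sum>(x,k)\<in>q. ?inc k) = (\<Sum>k\<in>snd ` q. ?inc k)"
  proof (rule sum.over_tagged_division_lemma[OF tagged_partial_division_of_Union_self[OF qt]])
    fix u v :: real assume "box u v = {}"
    then have "cbox u v = {} \<or> u = v" by (auto simp: not_less)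
    then show "?inc (cbox u v) = 0" by auto
  qed
  moreover have "(\<Sum>(x,k)\<in>q. ?inc k) = (\<Sum>(x,k)\<in>q. norm (\<phi> (Sup k) - \<phi> (Inf k)))"
    by (intro sum.cong refl) (use ne in auto)
  moreover have "(\<Sum>k\<in>snd ` q. ?inc k) = (\<Sum>k\<in>snd ` q. norm (\<phi> (Sup k) - \<phi> (Inf k)))"
    by (intro sum.cong refl) (use ne in auto)
  ultimately have qsum': "(\<Sum>(x,k)\<in>q. norm (\<phi> (Sup k) - \<phi> (Inf k))) = (\<Sum>k\<in>snd ` q. norm (\<phi> (Sup k) - \<phi> (Inf k)))"
    by simp
  have "\<phi> b - \<phi> a = (\<Sum>(x,k)\<in>p. \<phi> (Sup k) - \<phi> (Inf k))"
    using additive_tagged_division_1[OF ab p(1), of \<phi>] by simp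
  also have "\<dots> \<le> (\<Sum>(x,k)\<in>p. e * (Sup k - Inf k) + (if x \<in> N then norm (\<phi> (Sup k) - \<phi> (Inf k)) else 0))"
  proof (rule sum_mono, clarify)
    fix x k assume xk: "(x, k) \<in> p"
    then obtain u v where uv: "k = {u..v}" "u \<le> x" "x \<le> v" "u \<in> {a..b}" "v \<in> {a..b}" "\<bar>u - x\<bar> < d x" "\<bar>v - x\<bar> < d x"
      using box by blast
    have eb: "0 \<le> e * (v - u)" using e(1) uv by simp
    show "\<phi> (Sup k) - \<phi> (Inf k) \<le> e * (Sup k - Inf k) + (if x \<in> N then norm (\<phi> (Sup k) - \<phi> (Inf k)) else 0)"
    proof (cases "x \<in> N")
      case True
      have "\<phi> v - \<phi> u \<le> e * (v - u) + norm (\<phi> v - \<phi> u)" using eb by (simp add: abs_if)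
      then show ?thesis using True uv by simp
    next
      case False
      then have "\<phi> v - \<phi> u \<le> e * (v - u)" using uv by (intro d(3)[of x]) auto
      then show ?thesis using uv False by simp
    qed
  qed
  also have "\<dots> = e * (\<Sum>(x,k)\<in>p. Sup k - Inf k) + (\<Sum>(x,k)\<in>p. if x \<in> N then norm (\<phi> (Sup k) - \<phi> (Inf k)) else 0)"
    by (simp add: sum.distrib sum_distrib_left split_def)
  also have "(\<Sum>(x,k)\<in>p. Sup k - Inf k) = b - a"
    using additive_tagged_division_1[OF ab p(1), of "\<lambda>x. x"] by simp
  also have "(\<Sum>(x,k)\<in>p. if x \<in> N then norm (\<phi> (Sup k) - \<phi> (Inf k)) else 0) = (\<Sum>(x,k)\<in>q. norm (\<phi> (Sup k) - \<phi> (Inf k)))"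
    by (rule sum.mono_neutral_cong_right[OF fp qp]) (auto simp: q_def split: if_splits)
  finally show "\<phi> b \<le> \<phi> a + e0" using qsum qsum' e(2) by simp
qed

section \<open>Caratheodory solutions\<close>

lemma caratheodory_integrand:
  fixes F :: "'a::euclidean_space \<Rightarrow> 'b::euclidean_space \<Rightarrow> 'a"
  assumes D: "compact D" and Fc: "continuous_on (UNIV \<times> D) (\<lambda>(x, d). F x d)"
    and d: "d \<in> controls T D" and y: "continuous_on {0..T} y"
  shows "(\<lambda>s. F (y s) (d s)) \<in> borel_measurable (lebesgue_on {0..T})"
    and "\<exists>M. \<forall>s\<in>{0..T}. norm (F (y s) (d s)) \<le> M"
    and "(\<lambda>s. F (y s) (d s)) integrable_on {0..T}"
proof -
  have dm: "d \<in> borel_measurable (lebesgue_on {0..T})" and dD: "\<And>s. s \<in> {0..T} \<Longrightarrow> d s \<in> D"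
    using d by (auto simp: controls_def)
  have ym: "y \<in> borel_measurable (lebesgue_on {0..T})"
    using y by (intro continuous_imp_measurable_on_sets_lebesgue) auto
  have "(\<lambda>s. (y s, d s)) \<in> lebesgue_on {0..T} \<rightarrow>\<^sub>M restrict_space borel (UNIV \<times> D)"
    by (rule measurable_restrict_space2) (use dD in \<open>auto intro!: borel_measurable_Pair ym dm\<close>)
  from measurable_compose[OF this borel_measurable_continuous_on_restrict[OF Fc]]
  show m: "(\<lambda>s. F (y s) (d s)) \<in> borel_measurable (lebesgue_on {0..T})" by simp
  have "compact (y ` {0..T} \<times> D)"
    using y D by (intro compact_Times compact_continuous_image) auto
  then have "compact ((\<lambda>(x, d). F x d) ` (y ` {0..T} \<times> D))"
    by (intro compact_continuous_image continuous_on_subset[OF Fc]) auto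
  then obtain M where M: "\<And>z. z \<in> (\<lambda>(x, d). F x d) ` (y ` {0..T} \<times> D) \<Longrightarrow> norm z \<le> M"
    using compact_imp_bounded bounded_iff by metis
  then have M': "norm (F (y s) (d s)) \<le> M" if "s \<in> {0..T}" for s
    using that dD[OF that] by force
  then show "\<exists>M. \<forall>s\<in>{0..T}. norm (F (y s) (d s)) \<le> M" by blast
  show "(\<lambda>s. F (y s) (d s)) integrable_on {0..T}"
    by (rule measurable_bounded_by_integrable_imp_integrable[OF m, of "\<lambda>_. M"]) (use M' in auto)
qed

text \<open>A bound on the integrand is a Lipschitz constant of \<open>y\<close>, whence absolute
  continuity; the null set left by differentiating the integral is the exceptional set of the
  equation.\<close>

lemma integral_equation_ode_solution:
  fixes F :: "'a::euclidean_space \<Rightarrow> 'b::euclidean_space \<Rightarrow> 'a"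
  assumes D: "compact D" and Fc: "continuous_on (UNIV \<times> D) (\<lambda>(x, d). F x d)"
    and d: "d \<in> controls T D" and y: "continuous_on {0..T} y" and "0 \<le> T"
    and eq: "\<And>t. t \<in> {0..T} \<Longrightarrow> y t = x0 + integral {0..t} (\<lambda>s. F (y s) (d s))"
  shows "ode_solution T F d x0 y"
proof -
  let ?u = "\<lambda>s. F (y s) (d s)"
  note um = caratheodory_integrand(1)[OF D Fc d y] and ui = caratheodory_integrand(3)[OF D Fc d y]
  obtain M where M: "\<And>s. s \<in> {0..T} \<Longrightarrow> norm (?u s) \<le> M"
    using caratheodory_integrand(2)[OF D Fc d y] by blast
  have M0: "0 \<le> M" using M[of 0] \<open>0 \<le> T\<close> by (meson atLeastAtMost_iff norm_ge_zero order.refl order_trans)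
  have step: "norm (y t - y s) \<le> M * (t - s)" if "s \<le> t" "s \<in> {0..T}" "t \<in> {0..T}" for s t
  proof -
    have "integral {0..s} ?u + integral {s..t} ?u = integral {0..t} ?u"
      using that by (intro Henstock_Kurzweil_Integration.integral_combine integrable_on_subinterval[OF ui]) auto
    then have "y t - y s = integral {s..t} ?u" using eq that by (auto simp: algebra_simps)
    moreover have "norm (integral {s..t} ?u) \<le> integral {s..t} (\<lambda>_. M)"
      using that by (intro integral_norm_bound_integral integrable_on_subinterval[OF ui] M) auto
    ultimately show ?thesis using that by (simp add: mult.commute)
  qed
  have "M-lipschitz_on {0..T} y"
  proof (rule lipschitz_onI[OF _ M0])
    fix s t assume "s \<in> {0..T}" "t \<in> {0..T}"
    then show "dist (y s) (y t) \<le> M * dist s t"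
      using step[of s t] step[of t s] by (cases "s \<le> t") (auto simp: dist_norm norm_minus_commute)
  qed
  then have ac: "abs_continuous_on_interval 0 T y" by (rule abs_continuous_on_interval_lipschitz)
  have y0: "y 0 = x0" using eq[of 0] \<open>0 \<le> T\<close> by simp
  obtain N where N: "negligible N"
    "\<And>t. t \<in> {0..T} - N \<Longrightarrow> ((\<lambda>s. integral {0..s} ?u) has_vector_derivative ?u t) (at t within {0..T})"
    using indefinite_integral_has_vector_derivative_ae[OF um M] by metis
  have der: "(y has_vector_derivative ?u t) (at t within {0..T})" if "t \<in> {0..T} - N" for t
  proof -
    have "((\<lambda>s. x0 + integral {0..s} ?u) has_vector_derivative ?u t) (at t within {0..T})"
      using has_vector_derivative_add[OF has_vector_derivative_const N(2)[OF that]] by simp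
    then show ?thesis
      by (rule has_vector_derivative_transform[rotated 2]) (use that eq in auto)
  qed
  have "AE s in lebesgue_on {0..T}. (y has_vector_derivative ?u s) (at s within {0..T})"
  proof -
    have "AE s in lebesgue. s \<notin> N"
      using N(1) by (intro AE_not_in) (simp add: negligible_iff_null_sets)
    then show ?thesis
      by (subst AE_restrict_space_iff) (use der in \<open>auto elim!: eventually_mono\<close>)
  qed
  with ac y0 show ?thesis by (simp add: ode_solution_def)
qed

text \<open>Picard iteration for the rescaled unknown \<open>z t = exp (- (L + 1) * t) * y t\<close>, for which the
  integral operator is a contraction on all of \<open>[0,T]\<close> at once.\<close>

theorem caratheodory_solution_exists:
  fixes F :: "'a::euclidean_space \<Rightarrow> 'b::euclidean_space \<Rightarrow> 'a"
  assumes D: "compact D" and Fc: "continuous_on (UNIV \<times> D) (\<lambda>(x, d). F x d)"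
    and d: "d \<in> controls T D" and "0 \<le> T"
    and lip: "\<And>e. e \<in> D \<Longrightarrow> L-lipschitz_on UNIV (\<lambda>x. F x e)"
  shows "\<exists>y. ode_solution T F d x0 y"
proof -
  have dD: "\<And>s. s \<in> {0..T} \<Longrightarrow> d s \<in> D"
    using d by (auto simp: controls_def)
  have L: "0 \<le> L" using lip[OF dD[of 0]] \<open>0 \<le> T\<close> lipschitz_on_nonneg by auto
  \<comment> \<open>The contraction factor will be \<open>L / K\<close>, so \<open>K\<close> has to
    exceed \<open>L\<close>; it is also positive when \<open>L = 0\<close>.\<close>
  define K where "K = L + 1"
  have K: "0 < K" using L by (simp add: K_def)
  define U where "U z s = F (exp (K * s) *\<^sub>R z s) (d s)" for z :: "real \<Rightarrow> 'a" and s
  define P where "P z t = exp (- (K * t)) *\<^sub>R (x0 + integral {0..t} (U z))" for z t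
  have cz: "continuous_on {0..T} (\<lambda>s. exp (K * s) *\<^sub>R apply_bcontfun z s)" for z :: "real \<Rightarrow>\<^sub>C 'a"
    by (intro continuous_intros continuous_on_apply_bcontfun)
  have Ui: "U (apply_bcontfun z) integrable_on {0..T}" for z
    unfolding U_def using caratheodory_integrand(3)[OF D Fc d cz] by simp
  \<comment> \<open>The fixed point is sought among bounded continuous functions on the whole line,
    a complete space. \<open>P\<close> yields continuity only on \<open>[0,T]\<close>, so its values
    are extended as constants beyond both ends.\<close>
  have "\<exists>h :: real \<Rightarrow>\<^sub>C 'a. \<forall>x. apply_bcontfun h x = P (apply_bcontfun z) (clamp 0 T x)" for z
  proof -
    have "continuous_on (cbox 0 T) (P (apply_bcontfun z))"
      unfolding P_def using indefinite_integral_continuous_1[OF Ui] by (intro continuous_intros) simp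
    then show ?thesis using continuous_on_cbox_bcontfunE by metis
  qed
  then obtain G :: "(real \<Rightarrow>\<^sub>C 'a) \<Rightarrow> (real \<Rightarrow>\<^sub>C 'a)"
    where G: "\<And>z x. apply_bcontfun (G z) x = P (apply_bcontfun z) (clamp 0 T x)" by metis
  have clampT: "clamp 0 T x \<in> {0..T}" for x
    using clamp_in_interval[of "0::real" T x] \<open>0 \<le> T\<close> by simp
  have contr: "dist (G z) (G w) \<le> L / K * dist z w" for z w
  proof (rule dist_bound)
    fix x
    define t where "t = clamp 0 T x"
    have t: "0 \<le> t" "t \<le> T" using clampT[of x] by (auto simp: t_def)
    have sub: "{0..t} \<subseteq> {0..T}" using t by auto
    \<comment> \<open>The growth \<open>exp (K * s)\<close> integrates to
      \<open>(exp (K * t) - 1) / K\<close>, and the prefactor \<open>exp (- (K * t))\<close> of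
      \<open>P\<close> cancels it up to \<open>1 / K\<close>, whatever the length of
      \<open>[0,T]\<close>.\<close>
    have bnd: "norm (U z s - U w s) \<le> L * dist z w * exp (K * s)" if s: "s \<in> {0..t}" for s
    proof -
      have "norm (U z s - U w s) \<le> L * dist (exp (K * s) *\<^sub>R z s) (exp (K * s) *\<^sub>R w s)"
        unfolding U_def dist_norm[symmetric]
        by (rule lipschitz_onD[OF lip]) (use dD sub s in auto)
      also have "\<dots> = L * (exp (K * s) * dist (z s) (w s))"
        by (simp add: dist_norm flip: scaleR_diff_right)
      also have "\<dots> \<le> L * (exp (K * s) * dist z w)"
        using L by (intro mult_left_mono dist_bounded) auto
      finally show ?thesis by (simp add: mult_ac)
    qed
    have "((\<lambda>s. exp (K * s) / K) has_real_derivative exp (K * s)) (at s within {0..t})" for s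
      using K by (auto intro!: derivative_eq_intros)
    then have "((\<lambda>s. exp (K * s)) has_integral (exp (K * t) / K - exp (K * 0) / K)) {0..t}"
      using t by (intro fundamental_theorem_of_calculus)
        (simp_all add: has_real_derivative_iff_has_vector_derivative)
    from has_integral_mult_right[OF this, of "L * dist z w"]
    have ex: "((\<lambda>s. L * dist z w * exp (K * s)) has_integral L * dist z w * ((exp (K * t) - 1) / K)) {0..t}"
      by (simp add: diff_divide_distrib)
    have "integral {0..t} (U z) - integral {0..t} (U w) = integral {0..t} (\<lambda>s. U z s - U w s)"
      by (intro integral_diff[symmetric] integrable_on_subinterval[OF Ui] sub)
    also have "norm \<dots> \<le> integral {0..t} (\<lambda>s. L * dist z w * exp (K * s))"
    proof (rule integral_norm_bound_integral)
      show "(\<lambda>s. U z s - U w s) integrable_on {0..t}"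
        by (intro integrable_diff integrable_on_subinterval[OF Ui] sub)
    qed (use ex bnd in auto)
    also have "\<dots> = L * dist z w * ((exp (K * t) - 1) / K)" using ex by (rule integral_unique)
    finally have n: "norm (integral {0..t} (U z) - integral {0..t} (U w)) \<le> L * dist z w * ((exp (K * t) - 1) / K)" .
    have "dist (G z x) (G w x) = exp (- (K * t)) * norm (integral {0..t} (U z) - integral {0..t} (U w))"
      by (simp add: G P_def dist_norm t_def flip: scaleR_diff_right)
    also have "\<dots> \<le> exp (- (K * t)) * (L * dist z w * ((exp (K * t) - 1) / K))"
      using n by (intro mult_left_mono) auto
    also have "\<dots> = L / K * dist z w * (1 - exp (- (K * t)))"
      using K by (simp add: exp_minus field_simps)
    also have "\<dots> \<le> L / K * dist z w * 1"
      using L K by (intro mult_left_mono) auto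
    finally show "dist (G z x) (G w x) \<le> L / K * dist z w" by simp
  qed
  have "\<exists>!z. G z = z"
    by (rule banach_fix_type[of "L / K"]) (use L K contr in \<open>auto simp: K_def\<close>)
  then obtain z where z: "G z = z" by blast
  define y where "y t = exp (K * t) *\<^sub>R apply_bcontfun z t" for t
  have "ode_solution T F d x0 y"
  proof (rule integral_equation_ode_solution[OF D Fc d _ \<open>0 \<le> T\<close>])
    show "continuous_on {0..T} y" unfolding y_def by (rule cz)
    fix t assume t: "t \<in> {0..T}"
    then have "apply_bcontfun z t = P (apply_bcontfun z) t" using G[of z t] z by simp
    then have "y t = exp (K * t) *\<^sub>R exp (- (K * t)) *\<^sub>R (x0 + integral {0..t} (U z))"
      by (simp add: y_def P_def)
    also have "\<dots> = x0 + integral {0..t} (U z)" by (simp flip: exp_add)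
    also have "U z = (\<lambda>s. F (y s) (d s))" by (simp add: U_def y_def fun_eq_iff)
    finally show "y t = x0 + integral {0..t} (\<lambda>s. F (y s) (d s))" .
  qed
  then show ?thesis by blast
qed

section \<open>Super-solutions along trajectories\<close>

lemma Cinf_on_has_derivative:
  assumes "Cinf_on S v"
  obtains v' where "\<And>z. z \<in> S \<Longrightarrow> (v has_derivative v' z) (at z within S)"
    "\<And>b. b \<in> Basis \<Longrightarrow> continuous_on S (\<lambda>z. v' z b)"
proof -
  have "Ck_on (Suc 0) S v" using assms by (simp add: Cinf_on_def del: Ck_on.simps)
  then show thesis using that by auto
qed

text \<open>Smoothness supplies continuity of the partial derivatives only. Their bounds on the
  compact set add up to a bound for the operator norm, and the mean value inequality applies by
  convexity.\<close>

lemma lipschitz_on_compact_convex: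
  fixes v :: "'a::euclidean_space \<Rightarrow> real"
  assumes der: "\<And>z. z \<in> S \<Longrightarrow> (v has_derivative v' z) (at z within S)"
    and cont: "\<And>b. b \<in> Basis \<Longrightarrow> continuous_on S (\<lambda>z. v' z b)"
    and A: "A \<subseteq> S" "compact A" "convex A"
  shows "\<exists>C. C-lipschitz_on A v"
proof -
  have "\<forall>b\<in>Basis. \<exists>M. \<forall>z\<in>A. \<bar>v' z b\<bar> \<le> M"
  proof
    fix b :: 'a assume "b \<in> Basis"
    then have "compact ((\<lambda>z. v' z b) ` A)"
      using A cont continuous_on_subset by (intro compact_continuous_image) blast+
    then have "bounded ((\<lambda>z. v' z b) ` A)" by (rule compact_imp_bounded)
    then show "\<exists>M. \<forall>z\<in>A. \<bar>v' z b\<bar> \<le> M" by (auto simp: bounded_iff)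
  qed
  then obtain M where M: "\<And>b z. b \<in> Basis \<Longrightarrow> z \<in> A \<Longrightarrow> \<bar>v' z b\<bar> \<le> M b" by metis
  \<comment> \<open>The absolute value makes \<open>C\<close> nonnegative even for empty
    \<open>A\<close>, where nothing constrains \<open>M\<close>.\<close>
  define C where "C = \<bar>\<Sum>b\<in>Basis. M b\<bar>"
  have on: "onorm (v' z) \<le> C" if z: "z \<in> A" for z
  proof (rule onorm_bound)
    show "0 \<le> C" by (simp add: C_def)
    fix h
    have bl: "bounded_linear (v' z)" using der z A by (auto intro: has_derivative_bounded_linear)
    have "v' z h = v' z (\<Sum>b\<in>Basis. (h \<bullet> b) *\<^sub>R b)" by (simp add: euclidean_representation)
    also have "\<dots> = (\<Sum>b\<in>Basis. (h \<bullet> b) * v' z b)"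
      using bounded_linear.linear[OF bl] by (simp add: linear_sum linear_scale)
    also have "\<bar>\<dots>\<bar> \<le> (\<Sum>b\<in>Basis. norm h * M b)"
    proof (rule order_trans[OF sum_abs], rule sum_mono)
      fix b :: 'a assume "b \<in> Basis"
      then show "\<bar>(h \<bullet> b) * v' z b\<bar> \<le> norm h * M b"
        unfolding abs_mult using M z Basis_le_norm by (intro mult_mono) auto
    qed
    also have "\<dots> = (\<Sum>b\<in>Basis. M b) * norm h" by (simp add: sum_distrib_left mult.commute)
    also have "\<dots> \<le> C * norm h" by (intro mult_right_mono) (auto simp: C_def)
    finally show "norm (v' z h) \<le> C * norm h" by simp
  qed
  have "C-lipschitz_on A v"
  proof (rule lipschitz_onI)
    fix x y assume "x \<in> A" "y \<in> A"
    then show "dist (v x) (v y) \<le> C * dist x y"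
      unfolding dist_norm
      by (intro differentiable_bound[where f' = v', OF A(3) _ on])
         (use der A in \<open>auto intro: has_derivative_subset\<close>)
  qed (simp add: C_def)
  then show ?thesis by blast
qed

text \<open>A slice of constant time lies wholly in the strip, so the relative derivative restricts
  to an ordinary one in \<open>x\<close>, also at times \<open>0\<close> and \<open>T\<close>. Its
  representing vector \<open>p\<close> is the unique value of the description in
  \<open>grad_x\<close>.\<close>

lemma grad_x_inner:
  fixes v :: "'a::euclidean_space \<times> real \<Rightarrow> real"
  assumes der: "(v has_derivative v') (at (x, t) within time_strip T)" and t: "t \<in> {0..T}"
  shows "grad_x v x t \<bullet> h = v' (h, 0)"
proof -
  have "(v has_derivative v') (at (x, t) within (\<lambda>y. (y, t)) ` UNIV)"
    by (rule has_derivative_subset[OF der]) (use t in \<open>auto simp: time_strip_def\<close>)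
  moreover have "((\<lambda>y. (y, t)) has_derivative (\<lambda>h. (h, 0))) (at x)"
    by (intro has_derivative_Pair has_derivative_ident has_derivative_const)
  ultimately have d: "((\<lambda>y. v (y, t)) has_derivative (\<lambda>h. v' (h, 0))) (at x)"
    using has_derivative_in_compose[of "\<lambda>y. (y, t)" "\<lambda>h. (h, 0)" x UNIV v v'] by simp
  have lin: "linear (\<lambda>h. v' (h, 0))"
    using has_derivative_bounded_linear[OF d] bounded_linear.linear by blast
  define p where "p = (\<Sum>b\<in>Basis. v' (b, 0) *\<^sub>R b)"
  have p: "h \<bullet> p = v' (h, 0)" for h
  proof -
    have "v' (h, 0) = v' (\<Sum>b\<in>Basis. (h \<bullet> b) *\<^sub>R b, 0)" by (simp add: euclidean_representation)
    also have "\<dots> = (\<Sum>b\<in>Basis. (h \<bullet> b) * v' (b, 0))"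
      by (simp only: linear_sum[OF lin] linear_scale[OF lin] real_scaleR_def)
    finally show ?thesis by (simp add: p_def inner_sum_right mult.commute)
  qed
  have "grad_x v x t = p"
    unfolding grad_x_def
  proof (rule the_equality)
    show "GDERIV (\<lambda>y. v (y, t)) x :> p" using d by (simp add: gderiv_def p)
    fix q assume "GDERIV (\<lambda>y. v (y, t)) x :> q"
    then have "(\<lambda>h. h \<bullet> q) = (\<lambda>h. v' (h, 0))"
      using d has_derivative_unique unfolding gderiv_def by blast
    then have "\<forall>h. h \<bullet> q = h \<bullet> p" using p by metis
    then show "q = p" by (simp only: vector_eq_ldot)
  qed
  then show ?thesis using p[of h] by (simp add: inner_commute)
qed

text \<open>As \<open>0 < T\<close>, no point of \<open>[0,T]\<close> is isolated, so the derivative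
  relative to the interval is unique, one-sided ends included.\<close>

lemma time_deriv_eq:
  fixes v :: "'a::euclidean_space \<times> real \<Rightarrow> real"
  assumes der: "(v has_derivative v') (at (x, t) within time_strip T)" and t: "t \<in> {0..T}" "0 < T"
  shows "time_deriv T v x t = v' (0, 1)"
proof -
  have "(v has_derivative v') (at (x, t) within (\<lambda>s. (x, s)) ` {0..T})"
    by (rule has_derivative_subset[OF der]) (auto simp: time_strip_def)
  moreover have "((\<lambda>s. (x, s)) has_derivative (\<lambda>h. (0, h))) (at t within {0..T})"
    by (intro has_derivative_Pair has_derivative_ident has_derivative_const)
  ultimately have d: "((\<lambda>s. v (x, s)) has_derivative (\<lambda>h. v' (0, h))) (at t within {0..T})"
    using has_derivative_in_compose[of "\<lambda>s. (x, s)" "\<lambda>h. (0, h)" t "{0..T}" v v'] by simp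
  have "linear v'" using has_derivative_bounded_linear[OF der] bounded_linear.linear by blast
  then have eq: "(\<lambda>h. v' (0, h)) = (\<lambda>h. h *\<^sub>R v' (0, 1))"
  proof (intro ext)
    fix h :: real
    have "(0, h) = h *\<^sub>R (0::'a, 1)" by simp
    with \<open>linear v'\<close> show "v' (0, h) = h *\<^sub>R v' (0, 1)" by (metis linear_scale)
  qed
  have "((\<lambda>s. v (x, s)) has_vector_derivative v' (0, 1)) (at t within {0..T})"
    unfolding has_vector_derivative_def using d unfolding eq .
  then show ?thesis
    unfolding time_deriv_def using t by (intro vector_derivative_within_closed_interval) auto
qed

text \<open>A real \<open>SUP\<close> dominates its family only if that family is bounded above,
  which compactness of \<open>D\<close> and continuity of \<open>F\<close> ensure.\<close>

lemma Hamiltonian_upper: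
  assumes "compact D" "continuous_on (UNIV \<times> D) (\<lambda>(x, d). F x d)" "d \<in> D"
  shows "p \<bullet> F x d \<le> Hamiltonian F D x p"
proof -
  have "continuous_on D (\<lambda>d. (\<lambda>(x, d). F x d) (x, d))"
    by (rule continuous_on_compose2[OF assms(2)]) (auto intro!: continuous_intros)
  then have "continuous_on D (\<lambda>d. p \<bullet> F x d)" by (auto intro!: continuous_intros)
  then have "bdd_above ((\<lambda>d. p \<bullet> F x d) ` D)"
    using assms(1) by (intro bounded_imp_bdd_above compact_imp_bounded compact_continuous_image)
  then show ?thesis unfolding Hamiltonian_def by (rule cSUP_upper[OF assms(3)])
qed

text \<open>With \<open>v\<close> tested against itself the difference vanishes identically, so
  every point of the strip is a local minimum.\<close>

lemma viscosity_supersolution_smooth: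
  assumes "viscosity_supersolution T H nX g v" "Cinf_on (time_strip T) v" "t \<in> {0..<T}"
  shows "time_deriv T v x t + H x (grad_x v x t) \<le> 0" "max_upto nX (\<lambda>i. g i x t) \<le> v (x, t)"
proof -
  have "local_min_on (time_strip T) (\<lambda>z. v z - v z) (x, t)"
    using assms(3) by (auto simp: local_min_on_def time_strip_def intro: zero_less_one)
  then have "max (time_deriv T v x t + H x (grad_x v x t)) (max_upto nX (\<lambda>i. g i x t) - v (x, t)) \<le> 0"
    using assms unfolding viscosity_supersolution_def by blast
  then show "time_deriv T v x t + H x (grad_x v x t) \<le> 0" "max_upto nX (\<lambda>i. g i x t) \<le> v (x, t)"
    by auto
qed

lemma max_upto_ge: "i \<in> {1..k} \<Longrightarrow> a i \<le> max_upto k a"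
  by (auto simp: max_upto_def)

text \<open>The field \<open>f\<close> of the trajectory has to agree with \<open>F\<close> only
  along the trajectory and only before \<open>t\<close>. This serves solutions of \<open>F\<close>
  itself, where the premise is trivial, as well as solutions of \<open>f\<close> known to be in the
  ball up to time \<open>t\<close>.\<close>

lemma supersolution_nonincreasing_along_trajectory:
  fixes y :: "real \<Rightarrow> 'a::euclidean_space"
  assumes "0 < T" and D: "compact D" and Fc: "continuous_on (UNIV \<times> D) (\<lambda>(x, d). F x d)"
    and smooth: "Cinf_on (time_strip T) v"
    and super: "viscosity_supersolution T (Hamiltonian F D) nX g v"
    and d: "d \<in> controls T D" and sol: "ode_solution T f d x0 y"
    and t: "t \<in> {0..T}" and fF: "\<And>s. s \<in> {0..<t} \<Longrightarrow> f (y s) (d s) = F (y s) (d s)"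
  shows "v (y t, t) \<le> v (x0, 0)"
proof -
  have dD: "\<And>s. s \<in> {0..T} \<Longrightarrow> d s \<in> D" using d by (auto simp: controls_def)
  have ac: "abs_continuous_on_interval 0 T y" and y0: "y 0 = x0"
    and ae: "AE s in lebesgue_on {0..T}. (y has_vector_derivative f (y s) (d s)) (at s within {0..T})"
    using sol by (auto simp: ode_solution_def)
  obtain v' where v': "\<And>z. z \<in> time_strip T \<Longrightarrow> (v has_derivative v' z) (at z within time_strip T)"
    "\<And>b. b \<in> Basis \<Longrightarrow> continuous_on (time_strip T) (\<lambda>z. v' z b)"
    using Cinf_on_has_derivative[OF smooth] by blast
  have cont: "continuous_on {0..T} y" using ac by (rule abs_continuous_on_interval_continuous_on)
  then have "bounded (y ` {0..T})"
    by (intro compact_imp_bounded compact_continuous_image) auto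
  then obtain r where r: "y ` {0..T} \<subseteq> cball 0 r"
    using bounded_subset_ballD ball_subset_cball by (metis subset_trans)
  \<comment> \<open>Globally \<open>v\<close> need not be Lipschitz; the trajectory is bounded, so a
    compact convex cylinder around it suffices.\<close>
  obtain C where C: "C-lipschitz_on (cball 0 r \<times> {0..T}) v"
    using lipschitz_on_compact_convex[OF v', of "cball 0 r \<times> {0..T}"]
    by (auto simp: time_strip_def compact_Times convex_Times)
  have "abs_continuous_on_interval 0 T (\<lambda>s. v (y s, s))"
    by (rule abs_continuous_on_interval_compose_lipschitz[OF abs_continuous_on_interval_Pair_id[OF ac] C])
       (use r in auto)
  then have acv: "abs_continuous_on_interval 0 t (\<lambda>s. v (y s, s))"
    by (rule abs_continuous_on_interval_subset) (use t in auto)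
  obtain N where N: "negligible N"
    "\<And>s. s \<in> {0..T} - N \<Longrightarrow> (y has_vector_derivative f (y s) (d s)) (at s within {0..T})"
  proof -
    have "AE s in lebesgue. s \<in> {0..T} \<longrightarrow> (y has_vector_derivative f (y s) (d s)) (at s within {0..T})"
      using ae by (subst (asm) AE_restrict_space_iff) auto
    then obtain N where "N \<in> null_sets lebesgue"
      "{s. \<not> (s \<in> {0..T} \<longrightarrow> (y has_vector_derivative f (y s) (d s)) (at s within {0..T}))} \<subseteq> N"
      by (auto simp: eventually_ae_filter)
    then show thesis using that[of N] by (auto simp: negligible_iff_null_sets)
  qed
  have "v (y t, t) \<le> v (y 0, 0)"
  proof (rule abs_continuous_nonincreasing[OF acv])
    show "0 \<le> t" using t by simp
    show "negligible (insert t N)" using N(1) by simp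
    fix s assume s: "s \<in> {0..t} - insert t N"
    then have sT: "s \<in> {0..<T}" "s \<in> {0..T} - N" "s \<in> {0..<t}" using t by auto
    define D0 where "D0 = v' (y s, s) (F (y s) (d s), 1)"
    have z: "(y s, s) \<in> time_strip T" using sT by (simp add: time_strip_def)
    have "(y has_derivative (\<lambda>h. h *\<^sub>R F (y s) (d s))) (at s within {0..T})"
      using N(2)[OF sT(2)] fF[OF sT(3)] by (simp add: has_vector_derivative_def)
    then have "((\<lambda>s. (y s, s)) has_derivative (\<lambda>h. (h *\<^sub>R F (y s) (d s), h))) (at s within {0..T})"
      by (intro has_derivative_Pair has_derivative_ident)
    then have "((\<lambda>s. v (y s, s)) has_derivative (\<lambda>h. v' (y s, s) (h *\<^sub>R F (y s) (d s), h))) (at s within {0..T})"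
      by (rule has_derivative_in_compose2[where g = v and f = "\<lambda>s. (y s, s)" and t = "time_strip T", rotated 3])
         (use v'(1) sT in \<open>auto simp: time_strip_def\<close>)
    moreover have lin: "linear (v' (y s, s))"
      using has_derivative_bounded_linear[OF v'(1)[OF z]] bounded_linear.linear by blast
    then have "v' (y s, s) (h *\<^sub>R F (y s) (d s), h) = D0 * h" for h
      using linear_scale[OF lin, of h "(F (y s) (d s), 1)"] by (simp add: D0_def mult.commute)
    ultimately have "((\<lambda>s. v (y s, s)) has_real_derivative D0) (at s within {0..T})"
      by (simp add: has_field_derivative_def)
    then have der: "((\<lambda>s. v (y s, s)) has_real_derivative D0) (at s within {0..t})"
      by (rule DERIV_subset) (use t in auto)
    have "D0 = v' (y s, s) (F (y s) (d s), 0) + v' (y s, s) (0, 1)"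
      using linear_add[OF lin, of "(F (y s) (d s), 0)" "(0, 1)"] by (simp add: D0_def)
    also have "\<dots> = time_deriv T v (y s) s + grad_x v (y s) s \<bullet> F (y s) (d s)"
      using time_deriv_eq[OF v'(1)[OF z]] grad_x_inner[OF v'(1)[OF z]] sT \<open>0 < T\<close> by simp
    also have "\<dots> \<le> time_deriv T v (y s) s + Hamiltonian F D (y s) (grad_x v (y s) s)"
      using Hamiltonian_upper[OF D Fc dD] sT by simp
    also have "\<dots> \<le> 0" by (rule viscosity_supersolution_smooth(1)[OF super smooth sT(1)])
    finally show "\<exists>D\<le>0. ((\<lambda>s. v (y s, s)) has_real_derivative D) (at s within {0..t})"
      using der by blast
  qed
  then show ?thesis by (simp add: y0)
qed

section \<open>Confinement of trajectories to the ball\<close>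

text \<open>A point of the region outside \<open>interior B\<close> lies on the frontier of
  \<open>B\<close>, so no constraint is active there. All constraints then hold strictly, by
  continuity also nearby, and a whole neighbourhood falls into the region and thus into
  \<open>B\<close>, a contradiction.\<close>

lemma state_region_subset_interior:
  fixes B :: "'a::euclidean_space set"
  assumes g: "\<And>i. i \<in> {1..k} \<Longrightarrow> continuous_on UNIV (\<lambda>x. g i x t)"
    and sub: "state_region k g t \<subseteq> B" and bd: "state_boundary k g t \<inter> frontier B = {}"
  shows "state_region k g t \<subseteq> interior B"
proof
  fix x assume x: "x \<in> state_region k g t"
  show "x \<in> interior B"
  proof (rule ccontr)
    assume "x \<notin> interior B"
    moreover have "x \<in> closure B" using x sub closure_subset by blast
    ultimately have nb: "x \<notin> state_boundary k g t" using bd by (auto simp: frontier_def)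
    have neg: "g i x t < 0" if i: "i \<in> {1..k}" for i
    proof -
      have "g i x t \<le> 0" using x i by (simp add: state_region_def sublevel_region_def)
      moreover have "g i x t \<noteq> 0" using nb x i unfolding state_boundary_def by blast
      ultimately show ?thesis by simp
    qed
    define V where "V = (\<Inter>i\<in>{1..k}. {x. g i x t < 0})"
    have "open V" unfolding V_def
      by (intro open_INT ballI open_Collect_less g continuous_on_const) auto
    moreover have "V \<subseteq> state_region k g t"
      by (auto simp: V_def state_region_def sublevel_region_def less_imp_le)
    then have "V \<subseteq> B" using sub by (rule subset_trans)
    moreover have "x \<in> V" using neg by (auto simp: V_def)
    ultimately show False using \<open>x \<notin> interior B\<close> interiorI by blast
  qed
qed

text \<open>Let \<tau> be the supremum of the times up to which \<open>y\<close> has stayed in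
  \<open>B\<close>. Closedness of \<open>B\<close> includes \<tau> itself; \<open>step\<close> then
  puts \<open>y \<tau>\<close> into the interior, and continuity would prolong the stay beyond
  \<tau> unless \<open>\<tau> = T\<close>.\<close>

lemma continuous_interval_invariance:
  fixes y :: "real \<Rightarrow> 'a::topological_space"
  assumes cont: "continuous_on {0..T} y" and "0 \<le> T" and "closed B"
    and y0: "y 0 \<in> B"
    and step: "\<And>t. t \<in> {0..T} \<Longrightarrow> (\<And>s. s \<in> {0..t} \<Longrightarrow> y s \<in> B) \<Longrightarrow> y t \<in> interior B"
  shows "\<forall>t\<in>{0..T}. y t \<in> B"
proof -
  define A where "A = {t \<in> {0..T}. \<forall>s\<in>{0..t}. y s \<in> B}"
  define \<tau> where "\<tau> = Sup A"
  have A0: "0 \<in> A" using y0 \<open>0 \<le> T\<close> by (auto simp: A_def)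
  have bdd: "bdd_above A" by (rule bdd_aboveI[of _ T]) (auto simp: A_def)
  have "A \<noteq> {}" using A0 by blast
  have \<tau>: "0 \<le> \<tau>" unfolding \<tau>_def by (rule cSup_upper[OF A0 bdd])
  have "\<tau> \<le> T" unfolding \<tau>_def by (rule cSup_least[OF \<open>A \<noteq> {}\<close>]) (auto simp: A_def)
  note \<tau> = \<tau> this
  have less: "y s \<in> B" if s: "0 \<le> s" "s < \<tau>" for s
  proof -
    obtain t where "t \<in> A" "s < t"
      using s(2) \<open>A \<noteq> {}\<close> unfolding \<tau>_def by (rule less_cSupE)
    then show ?thesis using s by (auto simp: A_def)
  qed
  have "y \<tau> \<in> B"
  proof (cases "\<tau> = 0")
    case False
    then have "0 < \<tau>" using \<tau> by simp
    have "closedin (top_of_set {0..T}) ({0..T} \<inter> y -` B)"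
      using cont \<open>closed B\<close> by (rule continuous_closedin_preimage)
    then have "closed ({0..T} \<inter> y -` B)" by (rule closedin_closed_trans) simp
    moreover have "{0..<\<tau>} \<subseteq> {0..T} \<inter> y -` B" using less \<tau> by auto
    ultimately have "closure {0..<\<tau>} \<subseteq> {0..T} \<inter> y -` B" by (rule closure_minimal[rotated])
    then show ?thesis using \<open>0 < \<tau>\<close> by (auto simp: subset_iff)
  qed (use y0 in simp)
  then have upto: "\<And>s. s \<in> {0..\<tau>} \<Longrightarrow> y s \<in> B" using less by (auto simp: order_le_less)
  have "\<tau> = T"
  proof (rule ccontr)
    assume "\<tau> \<noteq> T"
    then have "\<tau> < T" using \<tau> by simp
    have "y \<tau> \<in> interior B" using step[of \<tau>] upto \<tau> by simp
    moreover have "openin (top_of_set {0..T}) ({0..T} \<inter> y -` interior B)"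
      using cont by (rule continuous_openin_preimage_gen) simp
    ultimately have "\<exists>e>0. \<forall>s\<in>{0..T}. dist s \<tau> < e \<longrightarrow> s \<in> {0..T} \<inter> y -` interior B"
      using \<tau> unfolding openin_euclidean_subtopology_iff by simp
    then obtain e where e: "0 < e" "\<And>s. s \<in> {0..T} \<Longrightarrow> dist s \<tau> < e \<Longrightarrow> y s \<in> interior B"
      by blast
    \<comment> \<open>A time strictly after \<tau>, capped at \<open>T\<close> and still within the
      distance \<open>e\<close> granted by continuity.\<close>
    define t where "t = min T (\<tau> + e / 2)"
    have "\<tau> < t" using \<open>\<tau> < T\<close> e(1) by (simp add: t_def)
    have "y s \<in> B" if s: "s \<in> {0..t}" for s
    proof (cases "s \<le> \<tau>")
      case False
      then have "s \<in> {0..T}" "dist s \<tau> < e" using e(1) s \<tau> by (auto simp: t_def dist_real_def)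
      then show ?thesis using e(2) interior_subset by blast
    qed (use s upto in auto)
    then have "t \<in> A" using \<tau> \<open>\<tau> < t\<close> by (auto simp: A_def t_def)
    then have "t \<le> \<tau>" unfolding \<tau>_def by (rule cSup_upper[OF _ bdd])
    with \<open>\<tau> < t\<close> show False by simp
  qed
  then show ?thesis using upto by auto
qed

theorem theorem3:
  fixes T R :: real
    and nD nX nTR :: nat
    and f F :: "real^'n \<Rightarrow> real^'m \<Rightarrow> real^'n"
    and h :: "nat \<Rightarrow> real^'m \<Rightarrow> real"
    and g :: "nat \<Rightarrow> real^'n \<Rightarrow> real \<Rightarrow> real"
    and l :: "nat \<Rightarrow> real^'n \<Rightarrow> real"
    and D :: "(real^'m) set"
    and X :: "real \<Rightarrow> (real^'n) set"
    and TR :: "(real^'n) set"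
    and \<psi> :: "(real^'n) \<times> real \<Rightarrow> real"
  assumes "0 < T" and "0 < R" and "1 \<le> nX" and "1 \<le> nTR"
    and f_poly: "\<And>j. real_polynomial_function (\<lambda>(x, d). f x d $ j)"
    and h_poly: "\<And>i. i \<in> {1..nD} \<Longrightarrow> real_polynomial_function (h i)"
    and g_poly: "\<And>i. i \<in> {1..nX} \<Longrightarrow> real_polynomial_function (\<lambda>(x, t). g i x t)"
    and l_poly: "\<And>i. i \<in> {1..nTR} \<Longrightarrow> real_polynomial_function (l i)"
    and D_def: "D = superlevel_region nD h"
    and X_def: "\<And>t. X t = state_region nX g t"
    and TR_def: "TR = sublevel_region nTR l"
    and D_compact: "compact D"
    and X_compact: "\<And>t. t \<in> {0..T} \<Longrightarrow> compact (X t)"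
    and X_subset: "\<And>t. t \<in> {0..T} \<Longrightarrow> X t \<subseteq> B0 R"
    and X_boundary: "\<And>t. t \<in> {0..T} \<Longrightarrow> state_boundary nX g t \<inter> frontier (B0 R) = {}"
    and F_cont: "continuous_on (UNIV \<times> D) (\<lambda>(x, d). F x d)"
    and F_lipschitz: "\<exists>L. \<forall>d\<in>D. L-lipschitz_on UNIV (\<lambda>x. F x d)"
    and F_eq_f: "\<And>x d. x \<in> B0 R \<Longrightarrow> d \<in> D \<Longrightarrow> F x d = f x d"
    and psi_smooth: "Cinf_on (time_strip T) \<psi>"
    and psi_super: "viscosity_supersolution T (Hamiltonian F D) nX g \<psi>"
    and psi_terminal: "\<And>x. \<psi> (x, T) \<ge>
          max (max_upto nTR (\<lambda>i. l i x)) (max_upto nX (\<lambda>i. g i x T))"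
  shows "{x. \<psi> (x, 0) \<le> 0} \<subseteq> backward_reachable_set T f D TR X"
proof
  fix x0 assume "x0 \<in> {x. \<psi> (x, 0) \<le> 0}"
  then have x0: "\<psi> (x0, 0) \<le> 0" by simp
  \<comment> \<open>Before \<open>T\<close> the second entry of the maximum in the super-solution
    inequality gives this; at \<open>T\<close> it is part of the boundary condition.\<close>
  have super: "max_upto nX (\<lambda>i. g i x t) \<le> \<psi> (x, t)" if "t \<in> {0..T}" for x t
    using viscosity_supersolution_smooth(2)[OF psi_super psi_smooth, of t x] psi_terminal[of x] that
    by (cases "t = T") auto
  have inX: "x \<in> X t" if "t \<in> {0..T}" "\<psi> (x, t) \<le> 0" for x t
    using super[OF that(1), of x] max_upto_ge[of _ nX "\<lambda>i. g i x t"] that(2)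
    unfolding X_def state_region_def sublevel_region_def by fastforce
  have inTR: "x \<in> TR" if "\<psi> (x, T) \<le> 0" for x
    using psi_terminal[of x] max_upto_ge[of _ nTR "\<lambda>i. l i x"] that
    unfolding TR_def sublevel_region_def by fastforce
  have gc: "continuous_on UNIV (\<lambda>x. g i x t)" if "i \<in> {1..nX}" for i t
  proof -
    have "continuous_on UNIV (\<lambda>(x, t). g i x t)"
      using continuous_real_polymonial_function[OF g_poly[OF that]] continuous_at_imp_continuous_on by blast
    then have "continuous_on UNIV (\<lambda>x. (\<lambda>(x, t). g i x t) (x, t))"
      by (rule continuous_on_compose2) (auto intro!: continuous_intros)
    then show ?thesis by simp
  qed
  have X_int: "X t \<subseteq> interior (B0 R)" if t: "t \<in> {0..T}" for t
    using state_region_subset_interior[OF gc, where t = t and B = "B0 R"] X_subset[OF t] X_boundary[OF t]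
    by (simp add: X_def)
  have B0_closed: "closed (B0 R :: (real^'n) set)"
    unfolding B0_def by (intro closed_Collect_le continuous_intros)
  obtain L where L: "\<And>d. d \<in> D \<Longrightarrow> L-lipschitz_on UNIV (\<lambda>x. F x d)" using F_lipschitz by blast
  note nonincr = supersolution_nonincreasing_along_trajectory[OF \<open>0 < T\<close> D_compact F_cont psi_smooth psi_super]
  show "x0 \<in> backward_reachable_set T f D TR X"
    unfolding backward_reachable_set_def
  proof (intro CollectI ballI conjI allI impI)
    fix d assume d: "d \<in> controls T D"
    then have dD: "\<And>s. s \<in> {0..T} \<Longrightarrow> d s \<in> D" by (auto simp: controls_def)
    obtain y where y: "ode_solution T F d x0 y"
      using caratheodory_solution_exists[OF D_compact F_cont d _ L] \<open>0 < T\<close> by force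
    \<comment> \<open>Along a solution of \<open>F\<close> the monotonicity of \<psi> holds
      unconditionally, so confinement follows at once, with no continuation argument.\<close>
    have "y s \<in> B0 R" if s: "s \<in> {0..T}" for s
      using nonincr[OF d y s] x0 inX[OF s, of "y s"] X_subset[OF s] by fastforce
    then have fF: "f (y s) (d s) = F (y s) (d s)" if "s \<in> {0..T}" for s
      using F_eq_f dD that by simp
    have "AE s in lebesgue_on {0..T}. (y has_vector_derivative F (y s) (d s)) (at s within {0..T})"
      using y by (simp add: ode_solution_def)
    moreover have "AE s in lebesgue_on {0..T}. s \<in> {0..T}" by (rule AE_I2) simp
    ultimately have "AE s in lebesgue_on {0..T}. (y has_vector_derivative f (y s) (d s)) (at s within {0..T})"
      by eventually_elim (simp add: fF)
    then have "ode_solution T f d x0 y"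
      using y by (simp add: ode_solution_def)
    then show "\<exists>y. ode_solution T f d x0 y" by blast
  next
    fix d y assume d: "d \<in> controls T D" and y: "ode_solution T f d x0 y"
    then have dD: "\<And>s. s \<in> {0..T} \<Longrightarrow> d s \<in> D" by (auto simp: controls_def)
    have cont: "continuous_on {0..T} y" and y0: "y 0 = x0"
      using y abs_continuous_on_interval_continuous_on by (auto simp: ode_solution_def)
    have psi_le: "\<psi> (y t, t) \<le> 0" if t: "t \<in> {0..T}" and "\<And>s. s \<in> {0..t} \<Longrightarrow> y s \<in> B0 R" for t
    proof -
      have "\<psi> (y t, t) \<le> \<psi> (x0, 0)"
        by (rule nonincr[OF d y t]) (use that dD F_eq_f in auto)
      with x0 show ?thesis by simp
    qed
    \<comment> \<open>Here the circularity is resolved: \<open>psi_le\<close> needs the ball up to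
      time \<open>t\<close> and returns \<open>y t \<in> X t\<close>, which \<open>X_int\<close>
      improves to the interior, as the continuation step requires.\<close>
    have inB: "\<forall>t\<in>{0..T}. y t \<in> B0 R"
    proof (rule continuous_interval_invariance[OF cont _ B0_closed])
      show "y 0 \<in> B0 R" using inX[of 0 x0] x0 X_subset[of 0] y0 \<open>0 < T\<close> by auto
      show "y t \<in> interior (B0 R)" if "t \<in> {0..T}" "\<And>s. s \<in> {0..t} \<Longrightarrow> y s \<in> B0 R" for t
        using X_int inX psi_le that by blast
    qed (use \<open>0 < T\<close> in simp)
    then have le: "\<psi> (y t, t) \<le> 0" if "t \<in> {0..T}" for t using psi_le that by auto
    show "y T \<in> TR" using inTR le[of T] \<open>0 < T\<close> by simp
    show "y s \<in> X s" if "s \<in> {0..T}" for s using inX le that by blast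
  qed
qed

end
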